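(* Every infinite stable field of finite weight and of finite degree of imperfection is perfect.
   Context: A stable field is a field $K$ considered as a first-order structure, endowed with its field operations and possibly additional relations, such that $\mathrm{Th}(K)$ is stable. By convention $K$ is a monster model (very saturated model) of its theory, and sets of parameters are small, i.e. of cardinality less than the degree of saturation. All complete types are finitary. Generics: a definable subset $X$ of a stable group $G$ is generic if finitely many translates of $X$ cover $G$; a complete type over a set $A$ is generic if every formula in it defines a generic set. An infinite stable field has a unique generic type (over each set of parameters), which is the generic type both of the additive and of the multiplicative group. Weight: in a stable theory with monster model $\mathfrak{C}$, for $A\subseteq \mathfrak{C}$ and $p\in S(A)$, the weight of $p$ is the supremum of the cardinalities $\kappa$ for which there exist a non-forking extension $q=\mathrm{tp}(a/B)\in S(B)$ of $p$ and a $B$-independent sequence $(b_i:i<\kappa)$ (of finite tuples) such that for every $i<\kappa$, $a$ is not independent (in the sense of forking) from $b_i$ over $A$. The weight of a stable field $K$ is the weight of its generic type. The degree of imperfection (Ershov invariant) of a field $K$ of characteristic $p>0$ is finite if and only if $K$ is a finite-dimensional vector space over its subfield $K^p=\{x^p:x\in K\}$ (it is then the $e$ with $[K:K^p]=p^e$). Fields of characteristic $0$ are perfect. *)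

theory Defs
  imports Complex_Main "HOL-Library.Extended_Nat" "HOL-Computational_Algebra.Computational_Algebra"
begin

unbundle cardinal_syntax

section \<open>Fields with additional relations as first-order structures\<close>

text \<open>
  Terms and formulas of the language of rings expanded by relation symbols. \<open>Par c\<close> is a constant
  naming the element \<open>c\<close> of the structure, so a formula over a set \<open>A\<close> of parameters is one all
  of whose \<open>Par\<close>s are in \<open>A\<close>. Relation symbols carry no arity: \<open>Rel r\<close> may be applied to lists of
  any length, that is, \<open>r\<close> stands for one relation symbol for each arity. A symbol of fixed arity
  is interpreted by a relation which is false on lists of any other length.
\<close>

datatype ('r, 'k) trm =
    Var nat
  | Par 'k
  | Zero
  | One
  | Add "('r, 'k) trm" "('r, 'k) trm"
  | Mul "('r, 'k) trm" "('r, 'k) trm"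
  | Minus "('r, 'k) trm"

datatype ('r, 'k) fm =
    Eq "('r, 'k) trm" "('r, 'k) trm"
  | Rel 'r "('r, 'k) trm list"
  | Not "('r, 'k) fm"
  | And "('r, 'k) fm" "('r, 'k) fm"
  | Ex nat "('r, 'k) fm"

primrec trm_vars :: "('r, 'k) trm \<Rightarrow> nat set" where
  "trm_vars (Var i) = {i}"
| "trm_vars (Par c) = {}"
| "trm_vars Zero = {}"
| "trm_vars One = {}"
| "trm_vars (Add s t) = trm_vars s \<union> trm_vars t"
| "trm_vars (Mul s t) = trm_vars s \<union> trm_vars t"
| "trm_vars (Minus t) = trm_vars t"

primrec trm_pars :: "('r, 'k) trm \<Rightarrow> 'k set" where
  "trm_pars (Var i) = {}"
| "trm_pars (Par c) = {c}"
| "trm_pars Zero = {}"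
| "trm_pars One = {}"
| "trm_pars (Add s t) = trm_pars s \<union> trm_pars t"
| "trm_pars (Mul s t) = trm_pars s \<union> trm_pars t"
| "trm_pars (Minus t) = trm_pars t"

primrec free_vars :: "('r, 'k) fm \<Rightarrow> nat set" where
  "free_vars (Eq s t) = trm_vars s \<union> trm_vars t"
| "free_vars (Rel r ts) = (\<Union>t\<in>set ts. trm_vars t)"
| "free_vars (Not \<phi>) = free_vars \<phi>"
| "free_vars (And \<phi> \<psi>) = free_vars \<phi> \<union> free_vars \<psi>"
| "free_vars (Ex i \<phi>) = free_vars \<phi> - {i}"

primrec pars :: "('r, 'k) fm \<Rightarrow> 'k set" where
  "pars (Eq s t) = trm_pars s \<union> trm_pars t"
| "pars (Rel r ts) = (\<Union>t\<in>set ts. trm_pars t)"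
| "pars (Not \<phi>) = pars \<phi>"
| "pars (And \<phi> \<psi>) = pars \<phi> \<union> pars \<psi>"
| "pars (Ex i \<phi>) = pars \<phi>"

primrec trm_val :: "(nat \<Rightarrow> 'k::field) \<Rightarrow> ('r, 'k) trm \<Rightarrow> 'k" where
  "trm_val e (Var i) = e i"
| "trm_val e (Par c) = c"
| "trm_val e Zero = 0"
| "trm_val e One = 1"
| "trm_val e (Add s t) = trm_val e s + trm_val e t"
| "trm_val e (Mul s t) = trm_val e s * trm_val e t"
| "trm_val e (Minus t) = - trm_val e t"

text \<open>
  The structure is the field \<open>'k\<close> (all of the type) with the relations given by \<open>R\<close>.
\<close>

primrec sat :: "('r \<Rightarrow> 'k::field list \<Rightarrow> bool) \<Rightarrow> (nat \<Rightarrow> 'k) \<Rightarrow> ('r, 'k) fm \<Rightarrow> bool" where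
  "sat R e (Eq s t) \<longleftrightarrow> trm_val e s = trm_val e t"
| "sat R e (Rel r ts) \<longleftrightarrow> R r (map (trm_val e) ts)"
| "sat R e (Not \<phi>) \<longleftrightarrow> \<not> sat R e \<phi>"
| "sat R e (And \<phi> \<psi>) \<longleftrightarrow> sat R e \<phi> \<and> sat R e \<psi>"
| "sat R e (Ex i \<phi>) \<longleftrightarrow> (\<exists>x. sat R (e(i := x)) \<phi>)"

text \<open>Formulas over \<open>A\<close> with free variables among the first \<open>n\<close> variables.\<close>

definition forms :: "'k set \<Rightarrow> nat \<Rightarrow> ('r, 'k) fm set" where
  "forms A n = {\<phi>. pars \<phi> \<subseteq> A \<and> free_vars \<phi> \<subseteq> {..<n}}"

text \<open>
  Truth of a formula at a finite tuple; the value \<open>0\<close> given to the variables beyond the length of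
  the tuple is irrelevant, as \<open>holds\<close> is only used with formulas in \<open>forms A (length a)\<close>.
\<close>

definition holds :: "('r \<Rightarrow> 'k::field list \<Rightarrow> bool) \<Rightarrow> 'k list \<Rightarrow> ('r, 'k) fm \<Rightarrow> bool" where
  "holds R a \<phi> \<longleftrightarrow> sat R (\<lambda>i. if i < length a then a ! i else 0) \<phi>"


section \<open>Types, saturation, stability\<close>

definition tp :: "('r \<Rightarrow> 'k::field list \<Rightarrow> bool) \<Rightarrow> 'k set \<Rightarrow> 'k list \<Rightarrow> ('r, 'k) fm set" where
  "tp R A a = {\<phi> \<in> forms A (length a). holds R a \<phi>}"

definition complete_type ::
  "('r \<Rightarrow> 'k::field list \<Rightarrow> bool) \<Rightarrow> 'k set \<Rightarrow> nat \<Rightarrow> ('r, 'k) fm set \<Rightarrow> bool" where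
  "complete_type R A n p \<longleftrightarrow>
     p \<subseteq> forms A n \<and>
     (\<forall>F. finite F \<and> F \<subseteq> p \<longrightarrow> (\<exists>a. length a = n \<and> (\<forall>\<phi>\<in>F. holds R a \<phi>))) \<and>
     (\<forall>\<phi>\<in>forms A n. \<phi> \<in> p \<or> Not \<phi> \<in> p)"

text \<open>
  A monster model with degree of saturation \<open>\<kappa>\<close>: a \<open>\<kappa>\<close>-saturated structure where \<open>\<kappa>\<close> is
  greater than the cardinality of the set of formulas without parameters, i.e. uncountable and
  greater than the number of relation symbols.
\<close>

definition monster :: "('r \<Rightarrow> 'k::field list \<Rightarrow> bool) \<Rightarrow> 'c rel \<Rightarrow> bool" where
  "monster R \<kappa> \<longleftrightarrow>
     Card_order \<kappa> \<and> natLeq <o \<kappa> \<and> |UNIV :: 'r set| <o \<kappa> \<and>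
     (\<forall>A n p. |A| <o \<kappa> \<and> complete_type R A n p \<longrightarrow> (\<exists>a. length a = n \<and> tp R A a = p))"

text \<open>
  Stability of the theory of the structure: no formula \<open>\<phi>(x,y)\<close> has the order property. By
  compactness, a formula has the order property modulo the theory iff there are arbitrarily long
  finite sequences in the given model ordered by it.
\<close>

definition stable :: "('r \<Rightarrow> 'k::field list \<Rightarrow> bool) \<Rightarrow> bool" where
  "stable R \<longleftrightarrow>
     (\<forall>n m. \<forall>\<phi>\<in>forms {} (n + m). \<exists>N :: nat.
        \<not> (\<exists>a b. (\<forall>i<N. length (a i) = n \<and> length (b i) = m) \<and>
                 (\<forall>i<N. \<forall>j<N. holds R (a i @ b j) \<phi> \<longleftrightarrow> i < j)))"


section \<open>Forking and weight\<close>

text \<open>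
  The formula \<open>\<phi>(x,b)\<close>, with \<open>x\<close> an \<open>n\<close>-tuple of variables, divides over \<open>A\<close>: there are
  \<open>k\<close> and a sequence of realisations of the type of \<open>b\<close> over \<open>A\<close> such that the instances of \<open>\<phi>\<close>
  along the sequence are \<open>k\<close>-inconsistent.
\<close>

definition divides ::
  "('r \<Rightarrow> 'k::field list \<Rightarrow> bool) \<Rightarrow> 'k set \<Rightarrow> nat \<Rightarrow> ('r, 'k) fm \<Rightarrow> 'k list \<Rightarrow> bool" where
  "divides R A n \<phi> b \<longleftrightarrow>
     (\<exists>k. \<exists>f :: nat \<Rightarrow> 'k list.
        (\<forall>i. length (f i) = length b \<and> tp R A (f i) = tp R A b) \<and>
        (\<forall>I. finite I \<and> card I = k \<longrightarrow>
           \<not> (\<exists>a. length a = n \<and> (\<forall>i\<in>I. holds R (a @ f i) \<phi>))))"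

text \<open>
  A set \<open>q\<close> of formulas in \<open>n\<close> variables forks over \<open>A\<close> if it implies a finite disjunction of
  formulas \<open>\<phi>(x,b)\<close> dividing over \<open>A\<close>. Implication is modulo the elementary diagram of the
  structure; by compactness it only involves a finite part \<open>F\<close> of \<open>q\<close>.
\<close>

definition forks ::
  "('r \<Rightarrow> 'k::field list \<Rightarrow> bool) \<Rightarrow> 'k set \<Rightarrow> nat \<Rightarrow> ('r, 'k) fm set \<Rightarrow> bool" where
  "forks R A n q \<longleftrightarrow>
     (\<exists>F D. finite F \<and> F \<subseteq> q \<and> finite D \<and>
        (\<forall>(\<phi>, b)\<in>D. \<phi> \<in> forms {} (n + length b) \<and> divides R A n \<phi> b) \<and>
        (\<forall>a. length a = n \<and> (\<forall>\<psi>\<in>F. holds R a \<psi>) \<longrightarrow> (\<exists>(\<phi>, b)\<in>D. holds R (a @ b) \<phi>)))"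

text \<open>The tuple \<open>a\<close> is independent from \<open>C\<close> over \<open>A\<close>.\<close>

definition indep ::
  "('r \<Rightarrow> 'k::field list \<Rightarrow> bool) \<Rightarrow> 'k list \<Rightarrow> 'k set \<Rightarrow> 'k set \<Rightarrow> bool" where
  "indep R a A C \<longleftrightarrow> \<not> forks R A (length a) (tp R (A \<union> C) a)"

definition indep_family ::
  "('r \<Rightarrow> 'k::field list \<Rightarrow> bool) \<Rightarrow> 'k set \<Rightarrow> 'i set \<Rightarrow> ('i \<Rightarrow> 'k list) \<Rightarrow> bool" where
  "indep_family R B I b \<longleftrightarrow> (\<forall>i\<in>I. indep R (b i) B (\<Union>j\<in>I - {i}. set (b j)))"

text \<open>
  A family \<open>(b i)\<close>, \<open>i \<in> I\<close>, witnessing that the weight of the complete type \<open>p\<close> over \<open>A\<close> is at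
  least the cardinality of \<open>I\<close>. That \<open>indep R a A B\<close> holds says that \<open>tp R B a\<close> is a non-forking
  extension of \<open>p\<close>, since \<open>A \<union> B = B\<close>.
\<close>

definition weight_witness ::
  "('r \<Rightarrow> 'k::field list \<Rightarrow> bool) \<Rightarrow> 'c rel \<Rightarrow> 'k set \<Rightarrow> ('r, 'k) fm set \<Rightarrow>
   'k set \<Rightarrow> 'k list \<Rightarrow> 'i set \<Rightarrow> ('i \<Rightarrow> 'k list) \<Rightarrow> bool" where
  "weight_witness R \<kappa> A p B a I b \<longleftrightarrow>
     A \<subseteq> B \<and> |B| <o \<kappa> \<and> tp R A a = p \<and> indep R a A B \<and>
     |I| <o \<kappa> \<and> indep_family R B I b \<and> (\<forall>i\<in>I. \<not> indep R a A (set (b i)))"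

text \<open>The weight, with all infinite cardinals identified with \<open>\<infinity>\<close>.\<close>

definition weight ::
  "('r \<Rightarrow> 'k::field list \<Rightarrow> bool) \<Rightarrow> 'c rel \<Rightarrow> 'k set \<Rightarrow> ('r, 'k) fm set \<Rightarrow> enat" where
  "weight R \<kappa> A p =
     Sup {(if finite I then enat (card I) else \<infinity>) | I :: 'k set. \<exists>B a b. weight_witness R \<kappa> A p B a I b}"


section \<open>Generic types and the weight of a stable field\<close>

definition generic_set :: "'g::group_add set \<Rightarrow> bool" where
  "generic_set X \<longleftrightarrow> (\<exists>S. finite S \<and> (\<Union>s\<in>S. (\<lambda>x. s + x) ` X) = UNIV)"

text \<open>Generic types of the additive group.\<close>

definition generic_type ::
  "('r \<Rightarrow> 'k::field list \<Rightarrow> bool) \<Rightarrow> 'k set \<Rightarrow> ('r, 'k) fm set \<Rightarrow> bool" where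
  "generic_type R A p \<longleftrightarrow>
     complete_type R A 1 p \<and> (\<forall>\<phi>\<in>p. generic_set {x. holds R [x] \<phi>})"

text \<open>
  An infinite stable field has exactly one generic type over the empty set, so that the definite
  description is meaningful. As weight is defined through non-forking extensions, the weights of
  the generic types over other sets of parameters are the same.
\<close>

definition field_weight :: "('r \<Rightarrow> 'k::field list \<Rightarrow> bool) \<Rightarrow> 'c rel \<Rightarrow> enat" where
  "field_weight R \<kappa> = weight R \<kappa> {} (THE p. generic_type R {} p)"


section \<open>Imperfection\<close>

definition pth_powers :: "'k::field set" where
  "pth_powers = range (\<lambda>x. x ^ CHAR('k))"

text \<open>
  In characteristic \<open>p > 0\<close> the field is spanned by a finite set as a vector space over the
  subfield of \<open>p\<close>-th powers. Fields of characteristic \<open>0\<close> have degree of imperfection \<open>0\<close>.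
\<close>

definition finite_degree_of_imperfection :: "'k::field itself \<Rightarrow> bool" where
  "finite_degree_of_imperfection _ \<longleftrightarrow>
     CHAR('k) = 0 \<or>
     (\<exists>E :: 'k set. finite E \<and>
        (\<forall>x. \<exists>c. (\<forall>e\<in>E. c e \<in> pth_powers) \<and> x = (\<Sum>e\<in>E. c e * e)))"

definition perfect :: "'k::field itself \<Rightarrow> bool" where
  "perfect _ \<longleftrightarrow> CHAR('k) = 0 \<or> (pth_powers :: 'k set) = UNIV"

end

theory Submission
  imports Defs
begin

text \<open>
  Let \<open>K\<close> have characteristic \<open>p > 0\<close> and be imperfect of finite degree of imperfection. The field
  \<open>K\<close> has a finite basis \<open>E\<close> over its subfield of \<open>p ^ m\<close>-th powers, with at least \<open>m\<close> elements.
  Write a generic \<open>a\<close> over \<open>E\<close> as the sum of the \<open>r e ^ (p ^ m) * e\<close> for \<open>e \<in> E\<close>. Each coordinate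
  \<open>r e\<close> is generic over \<open>E\<close> and the other coordinates, so the tuples \<open>(r e, E)\<close> are independent over
  \<open>E\<close>, and \<open>a\<close> depends on each of them, so the weight is at least \<open>m\<close>, for every \<open>m\<close>.

  The general theory of forking is not needed: it suffices that definable generic sets do not
  divide. This holds because the additive group is locally finite, so that an \<open>n\<close>-generic set has
  density at least \<open>1 / n\<close> in all large finite subgroups.
\<close>

section \<open>Definable predicates on tuples\<close>

text \<open>Two facts about generics are proved by finite combinatorics. If neither a definable set
  nor its complement is generic, the relation \<open>x + y \<in> X\<close> has long orders. That the
  two are never both generic needs multiplication: in an additive group alone, a definable subgroup
  of finite index and its complement are both generic. The maps
  \<open>(v, w) \<mapsto> u * v + w\<close> make the preimages of such a set, for varying
  \<open>u\<close>, a family so well spread that it shatters large sets, against stability. The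
  obstacle behind the form of many statements is that genericity is not visibly first order, whereas
  \<open>N\<close>-genericity for a fixed \<open>N\<close> is. \<open>N\<close>-genericity therefore
  passes along types, which settles dividing; and the dichotomy bounds \<open>N\<close> uniformly in
  the parameters, which is what the coordinate argument needs to control all fibres by one formula.
  The basis is carried inside every tuple of the family because dependence is tested over the empty
  set, where the coordinate functions can be expressed only with the basis among the parameters of
  the formula.\<close>

abbreviation env :: "'k::zero list \<Rightarrow> nat \<Rightarrow> 'k" where
  "env a \<equiv> \<lambda>i. if i < length a then a ! i else 0"

lemma trm_val_cong:
  "(\<And>i. i \<in> trm_vars t \<Longrightarrow> e i = e' i) \<Longrightarrow> trm_val e t = trm_val e' t"
  by (induction t) auto

lemma sat_cong:
  "(\<And>i. i \<in> free_vars \<phi> \<Longrightarrow> e i = e' i) \<Longrightarrow> sat R e \<phi> \<longleftrightarrow> sat R e' \<phi>"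
proof (induction \<phi> arbitrary: e e')
  case (Eq s t)
  then show ?case using trm_val_cong[of s e e'] trm_val_cong[of t e e'] by auto
next
  case (Rel r ts)
  then have "map (trm_val e) ts = map (trm_val e') ts"
    by (intro map_cong refl trm_val_cong) auto
  then show ?case by (simp only: sat.simps)
next
  case (Not \<phi>)
  from Not.IH[of e e'] Not.prems show ?case by auto
next
  case (And \<phi> \<psi>)
  from And.IH(1)[of e e'] And.IH(2)[of e e'] And.prems show ?case by auto
next
  case (Ex j \<phi>)
  have "sat R (e(j := x)) \<phi> \<longleftrightarrow> sat R (e'(j := x)) \<phi>" for x
    by (rule Ex.IH) (use Ex.prems in auto)
  then show ?case by simp
qed

section \<open>Substitution of terms for variables\<close>

primrec trm_subst :: "(nat \<Rightarrow> ('r, 'k) trm) \<Rightarrow> ('r, 'k) trm \<Rightarrow> ('r, 'k) trm" where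
  "trm_subst \<sigma> (Var i) = \<sigma> i"
| "trm_subst \<sigma> (Par c) = Par c"
| "trm_subst \<sigma> Zero = Zero"
| "trm_subst \<sigma> One = One"
| "trm_subst \<sigma> (Add s t) = Add (trm_subst \<sigma> s) (trm_subst \<sigma> t)"
| "trm_subst \<sigma> (Mul s t) = Mul (trm_subst \<sigma> s) (trm_subst \<sigma> t)"
| "trm_subst \<sigma> (Minus t) = Minus (trm_subst \<sigma> t)"

lemma trm_val_subst: "trm_val e (trm_subst \<sigma> t) = trm_val (\<lambda>i. trm_val e (\<sigma> i)) t"
  by (induction t) auto

lemma trm_vars_subst: "trm_vars (trm_subst \<sigma> t) = (\<Union>i\<in>trm_vars t. trm_vars (\<sigma> i))"
  by (induction t) auto

lemma trm_pars_subst: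
  "trm_pars (trm_subst \<sigma> t) = trm_pars t \<union> (\<Union>i\<in>trm_vars t. trm_pars (\<sigma> i))"
  by (induction t) auto

lemma finite_trm_vars [simp]: "finite (trm_vars t)"
  by (induction t) auto

lemma finite_free_vars [simp]: "finite (free_vars \<phi>)"
  by (induction \<phi>) auto

lemma finite_trm_pars [simp]: "finite (trm_pars t)"
  by (induction t) auto

lemma finite_pars [simp]: "finite (pars \<phi>)"
  by (induction \<phi>) auto

text \<open>Bound variables must be renamed to avoid capture, so the result depends on choices of
  fresh variables. It is therefore given by existence, with its meaning and the bounds on its
  variables and parameters. The substitution varies in the induction since renaming changes
  it.\<close>

lemma fm_subst:
  fixes \<phi> :: "('r, 'k::field) fm" and \<sigma> :: "nat \<Rightarrow> ('r, 'k) trm"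
  shows "\<exists>\<phi>'. free_vars \<phi>' \<subseteq> (\<Union>i\<in>free_vars \<phi>. trm_vars (\<sigma> i)) \<and>
    pars \<phi>' \<subseteq> pars \<phi> \<union> (\<Union>i\<in>free_vars \<phi>. trm_pars (\<sigma> i)) \<and>
    (\<forall>e. sat R e \<phi>' \<longleftrightarrow> sat R (\<lambda>i. trm_val e (\<sigma> i)) \<phi>)"
proof (induction \<phi> arbitrary: \<sigma>)
  case (Eq s t)
  then show ?case
    by (intro exI[of _ "Eq (trm_subst \<sigma> s) (trm_subst \<sigma> t)"])
      (auto simp: trm_val_subst trm_vars_subst trm_pars_subst)
next
  case (Rel r ts)
  then show ?case
    by (intro exI[of _ "Rel r (map (trm_subst \<sigma>) ts)"])
      (auto simp: trm_val_subst trm_vars_subst trm_pars_subst comp_def)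
next
  case (Not \<phi>)
  from Not.IH[of \<sigma>] obtain \<phi>' where
    "free_vars \<phi>' \<subseteq> (\<Union>i\<in>free_vars \<phi>. trm_vars (\<sigma> i))"
    "pars \<phi>' \<subseteq> pars \<phi> \<union> (\<Union>i\<in>free_vars \<phi>. trm_pars (\<sigma> i))"
    "\<forall>e. sat R e \<phi>' \<longleftrightarrow> sat R (\<lambda>i. trm_val e (\<sigma> i)) \<phi>" by blast
  then show ?case by (intro exI[of _ "Not \<phi>'"]) auto
next
  case (And \<phi> \<psi>)
  from And.IH(1)[of \<sigma>] obtain \<phi>' where \<phi>':
    "free_vars \<phi>' \<subseteq> (\<Union>i\<in>free_vars \<phi>. trm_vars (\<sigma> i))"
    "pars \<phi>' \<subseteq> pars \<phi> \<union> (\<Union>i\<in>free_vars \<phi>. trm_pars (\<sigma> i))"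
    "\<forall>e. sat R e \<phi>' \<longleftrightarrow> sat R (\<lambda>i. trm_val e (\<sigma> i)) \<phi>" by blast
  from And.IH(2)[of \<sigma>] obtain \<psi>' where \<psi>':
    "free_vars \<psi>' \<subseteq> (\<Union>i\<in>free_vars \<psi>. trm_vars (\<sigma> i))"
    "pars \<psi>' \<subseteq> pars \<psi> \<union> (\<Union>i\<in>free_vars \<psi>. trm_pars (\<sigma> i))"
    "\<forall>e. sat R e \<psi>' \<longleftrightarrow> sat R (\<lambda>i. trm_val e (\<sigma> i)) \<psi>" by blast
  show ?case using \<phi>' \<psi>' by (intro exI[of _ "And \<phi>' \<psi>'"]) (auto dest: subsetD)
next
  case (Ex j \<phi>)
  \<comment> \<open>Fresh for every substituted term, so that quantifying over \<open>k\<close>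
    captures nothing.\<close>
  obtain k where k: "k \<notin> (\<Union>i\<in>free_vars \<phi>. trm_vars (\<sigma> i))"
    using ex_new_if_finite[of "\<Union>i\<in>free_vars \<phi>. trm_vars (\<sigma> i)"] by auto
  let ?\<sigma> = "\<sigma>(j := Var k)"
  from Ex.IH[of ?\<sigma>] obtain \<phi>' where \<phi>':
    "free_vars \<phi>' \<subseteq> (\<Union>i\<in>free_vars \<phi>. trm_vars (?\<sigma> i))"
    "pars \<phi>' \<subseteq> pars \<phi> \<union> (\<Union>i\<in>free_vars \<phi>. trm_pars (?\<sigma> i))"
    "\<And>e. sat R e \<phi>' \<longleftrightarrow> sat R (\<lambda>i. trm_val e (?\<sigma> i)) \<phi>" by blast
  have "sat R (e(k := x)) \<phi>' \<longleftrightarrow> sat R ((\<lambda>i. trm_val e (\<sigma> i))(j := x)) \<phi>" for e x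
  proof -
    have "trm_val (e(k := x)) (\<sigma> i) = trm_val e (\<sigma> i)" if "i \<in> free_vars \<phi>" for i
      by (rule trm_val_cong) (use that k in auto)
    then show ?thesis unfolding \<phi>'(3) by (intro sat_cong) auto
  qed
  moreover have "free_vars (Ex k \<phi>') \<subseteq> (\<Union>i\<in>free_vars (Ex j \<phi>). trm_vars (\<sigma> i))"
  proof
    fix v assume "v \<in> free_vars (Ex k \<phi>')"
    with \<phi>'(1) obtain i where "i \<in> free_vars \<phi>" "v \<in> trm_vars (?\<sigma> i)" "v \<noteq> k" by auto
    then show "v \<in> (\<Union>i\<in>free_vars (Ex j \<phi>). trm_vars (\<sigma> i))"
      by (cases "i = j") auto
  qed
  moreover have "pars (Ex k \<phi>') \<subseteq> pars (Ex j \<phi>) \<union> (\<Union>i\<in>free_vars (Ex j \<phi>). trm_pars (\<sigma> i))"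
  proof
    fix c assume "c \<in> pars (Ex k \<phi>')"
    with \<phi>'(2) consider "c \<in> pars \<phi>"
      | i where "i \<in> free_vars \<phi>" "c \<in> trm_pars (?\<sigma> i)" by auto
    then show "c \<in> pars (Ex j \<phi>) \<union> (\<Union>i\<in>free_vars (Ex j \<phi>). trm_pars (\<sigma> i))"
    proof cases
      case (2 i)
      then show ?thesis by (cases "i = j") auto
    qed simp
  qed
  ultimately show ?case by (intro exI[of _ "Ex k \<phi>'"]) auto
qed

section \<open>Turning parameters into variables\<close>

primrec trm_unpar :: "('k \<Rightarrow> nat) \<Rightarrow> ('r, 'k) trm \<Rightarrow> ('r, 'k) trm" where
  "trm_unpar f (Var i) = Var i"
| "trm_unpar f (Par c) = Var (f c)"
| "trm_unpar f Zero = Zero"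
| "trm_unpar f One = One"
| "trm_unpar f (Add s t) = Add (trm_unpar f s) (trm_unpar f t)"
| "trm_unpar f (Mul s t) = Mul (trm_unpar f s) (trm_unpar f t)"
| "trm_unpar f (Minus t) = Minus (trm_unpar f t)"

lemma trm_val_unpar:
  "(\<And>c. c \<in> trm_pars t \<Longrightarrow> e (f c) = c) \<Longrightarrow> trm_val e (trm_unpar f t) = trm_val e t"
  by (induction t) auto

lemma trm_pars_unpar [simp]: "trm_pars (trm_unpar f t) = {}"
  by (induction t) auto

text \<open>\<open>M\<close> exceeds every bound variable of the formula, so the variables
  \<open>f c\<close> standing for parameters are never captured. Injectivity of \<open>f\<close> on
  the parameters is implicit in the requirement \<open>e (f c) = c\<close>.\<close>

lemma fm_unpar:
  fixes \<phi> :: "('r, 'k::field) fm"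
  shows "\<exists>M. \<forall>f. (\<forall>c. M \<le> f c) \<longrightarrow> (\<exists>\<phi>'. pars \<phi>' = {} \<and>
    (\<forall>e. (\<forall>c\<in>pars \<phi>. e (f c) = c) \<longrightarrow> (sat R e \<phi>' \<longleftrightarrow> sat R e \<phi>)))"
proof (induction \<phi>)
  case (Eq s t)
  show ?case
  proof (intro exI[of _ 0] allI impI)
    fix f :: "'k \<Rightarrow> nat"
    show "\<exists>\<phi>'. pars \<phi>' = {} \<and>
      (\<forall>e. (\<forall>c\<in>pars (Eq s t). e (f c) = c) \<longrightarrow> (sat R e \<phi>' \<longleftrightarrow> sat R e (Eq s t)))"
      by (intro exI[of _ "Eq (trm_unpar f s) (trm_unpar f t)"]) (simp add: trm_val_unpar)
  qed
next
  case (Rel r ts)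
  show ?case
  proof (intro exI[of _ 0] allI impI)
    fix f :: "'k \<Rightarrow> nat"
    have "map (trm_val e) (map (trm_unpar f) ts) = map (trm_val e) ts"
      if "\<forall>c\<in>pars (Rel r ts). e (f c) = c" for e
      using that by (simp add: trm_val_unpar)
    then have "sat R e (Rel r (map (trm_unpar f) ts)) \<longleftrightarrow> sat R e (Rel r ts)"
      if "\<forall>c\<in>pars (Rel r ts). e (f c) = c" for e
      using that by (simp only: sat.simps)
    then show "\<exists>\<phi>'. pars \<phi>' = {} \<and>
      (\<forall>e. (\<forall>c\<in>pars (Rel r ts). e (f c) = c) \<longrightarrow> (sat R e \<phi>' \<longleftrightarrow> sat R e (Rel r ts)))"
      by (intro exI[of _ "Rel r (map (trm_unpar f) ts)"]) (simp del: sat.simps)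
  qed
next
  case (Not \<phi>)
  then obtain M where M: "\<And>f. \<forall>c. M \<le> f c \<Longrightarrow> \<exists>\<phi>'. pars \<phi>' = {} \<and>
    (\<forall>e. (\<forall>c\<in>pars \<phi>. e (f c) = c) \<longrightarrow> (sat R e \<phi>' \<longleftrightarrow> sat R e \<phi>))" by blast
  show ?case
  proof (intro exI[of _ M] allI impI)
    fix f :: "'k \<Rightarrow> nat" assume "\<forall>c. M \<le> f c"
    from M[OF this] obtain \<phi>' where "pars \<phi>' = {}"
      "\<forall>e. (\<forall>c\<in>pars \<phi>. e (f c) = c) \<longrightarrow> (sat R e \<phi>' \<longleftrightarrow> sat R e \<phi>)" by blast
    then show "\<exists>\<phi>'. pars \<phi>' = {} \<and>
      (\<forall>e. (\<forall>c\<in>pars (Not \<phi>). e (f c) = c) \<longrightarrow> (sat R e \<phi>' \<longleftrightarrow> sat R e (Not \<phi>)))"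
      by (intro exI[of _ "Not \<phi>'"]) simp
  qed
next
  case (And \<phi> \<psi>)
  from And.IH(1) obtain M where M: "\<And>f. \<forall>c. M \<le> f c \<Longrightarrow> \<exists>\<phi>'. pars \<phi>' = {} \<and>
    (\<forall>e. (\<forall>c\<in>pars \<phi>. e (f c) = c) \<longrightarrow> (sat R e \<phi>' \<longleftrightarrow> sat R e \<phi>))"
    by blast
  from And.IH(2) obtain N where N: "\<And>f. \<forall>c. N \<le> f c \<Longrightarrow> \<exists>\<phi>'. pars \<phi>' = {} \<and>
    (\<forall>e. (\<forall>c\<in>pars \<psi>. e (f c) = c) \<longrightarrow> (sat R e \<phi>' \<longleftrightarrow> sat R e \<psi>))" by blast
  show ?case
  proof (intro exI[of _ "max M N"] allI impI)
    fix f :: "'k \<Rightarrow> nat" assume "\<forall>c. max M N \<le> f c"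
    with M[of f] N[of f] obtain \<phi>' \<psi>' where "pars \<phi>' = {}" "pars \<psi>' = {}"
      "\<forall>e. (\<forall>c\<in>pars \<phi>. e (f c) = c) \<longrightarrow> (sat R e \<phi>' \<longleftrightarrow> sat R e \<phi>)"
      "\<forall>e. (\<forall>c\<in>pars \<psi>. e (f c) = c) \<longrightarrow> (sat R e \<psi>' \<longleftrightarrow> sat R e \<psi>)" by auto
    then show "\<exists>\<phi>'. pars \<phi>' = {} \<and>
      (\<forall>e. (\<forall>c\<in>pars (And \<phi> \<psi>). e (f c) = c) \<longrightarrow> (sat R e \<phi>' \<longleftrightarrow> sat R e (And \<phi> \<psi>)))"
      by (intro exI[of _ "And \<phi>' \<psi>'"]) simp
  qed
next
  case (Ex j \<phi>)
  then obtain M where M: "\<And>f. \<forall>c. M \<le> f c \<Longrightarrow> \<exists>\<phi>'. pars \<phi>' = {} \<and>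
    (\<forall>e. (\<forall>c\<in>pars \<phi>. e (f c) = c) \<longrightarrow> (sat R e \<phi>' \<longleftrightarrow> sat R e \<phi>))" by blast
  show ?case
  proof (intro exI[of _ "max M (Suc j)"] allI impI)
    fix f :: "'k \<Rightarrow> nat" assume f: "\<forall>c. max M (Suc j) \<le> f c"
    with M[of f] obtain \<phi>' where \<phi>': "pars \<phi>' = {}"
      "\<forall>e. (\<forall>c\<in>pars \<phi>. e (f c) = c) \<longrightarrow> (sat R e \<phi>' \<longleftrightarrow> sat R e \<phi>)" by auto
    moreover have "f c \<noteq> j" for c using f[rule_format, of c] by auto
    ultimately show "\<exists>\<phi>'. pars \<phi>' = {} \<and>
      (\<forall>e. (\<forall>c\<in>pars (Ex j \<phi>). e (f c) = c) \<longrightarrow> (sat R e \<phi>' \<longleftrightarrow> sat R e (Ex j \<phi>)))"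
      by (intro exI[of _ "Ex j \<phi>'"]) simp
  qed
qed

text \<open>Semantic counterpart of \<open>forms\<close>: a predicate matters only on lists of
  length \<open>n\<close>, so definability can be derived for HOL terms with indices,
  \<open>take\<close>, \<open>drop\<close> and quantifiers, without writing formulas.\<close>

definition definable ::
  "('r \<Rightarrow> 'k::field list \<Rightarrow> bool) \<Rightarrow> 'k set \<Rightarrow> nat \<Rightarrow> ('k list \<Rightarrow> bool) \<Rightarrow> bool" where
  "definable R A n P \<longleftrightarrow> (\<exists>\<phi>\<in>forms A n. \<forall>a. length a = n \<longrightarrow> (P a \<longleftrightarrow> holds R a \<phi>))"

text \<open>
  The argument \<open>R\<close> only serves to fix the type of the relation symbols.
\<close>

definition term_map ::
  "('r \<Rightarrow> 'k::field list \<Rightarrow> bool) \<Rightarrow> 'k set \<Rightarrow> nat \<Rightarrow> nat \<Rightarrow> ('k list \<Rightarrow> 'k list) \<Rightarrow> bool" where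
  "term_map R A n m g \<longleftrightarrow> (\<exists>ts :: ('r, 'k) trm list. length ts = m \<and>
     (\<forall>t\<in>set ts. trm_pars t \<subseteq> A \<and> trm_vars t \<subseteq> {..<n}) \<and>
     (\<forall>a. length a = n \<longrightarrow> g a = map (trm_val (env a)) ts))"

definition term_fun ::
  "('r \<Rightarrow> 'k::field list \<Rightarrow> bool) \<Rightarrow> 'k set \<Rightarrow> nat \<Rightarrow> ('k list \<Rightarrow> 'k) \<Rightarrow> bool" where
  "term_fun R A n f \<longleftrightarrow> (\<exists>t :: ('r, 'k) trm. trm_pars t \<subseteq> A \<and> trm_vars t \<subseteq> {..<n} \<and>
     (\<forall>a. length a = n \<longrightarrow> f a = trm_val (env a) t))"

lemma term_fun_const: "c \<in> A \<Longrightarrow> term_fun R A n (\<lambda>a. c)"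
  unfolding term_fun_def by (intro exI[of _ "Par c"]) auto

lemma term_fun_0: "term_fun R A n (\<lambda>a. 0)"
  unfolding term_fun_def by (intro exI[of _ Zero]) auto

lemma term_fun_1: "term_fun R A n (\<lambda>a. 1)"
  unfolding term_fun_def by (intro exI[of _ One]) auto

lemma term_fun_nth: "i < n \<Longrightarrow> term_fun R A n (\<lambda>a. a ! i)"
  unfolding term_fun_def by (intro exI[of _ "Var i"]) auto

lemma term_fun_add:
  fixes R :: "'r \<Rightarrow> 'k::field list \<Rightarrow> bool"
  assumes "term_fun R A n f" "term_fun R A n g"
  shows "term_fun R A n (\<lambda>a. f a + g a)"
proof -
  from assms obtain s t :: "('r, 'k) trm" where
    "trm_pars s \<subseteq> A" "trm_vars s \<subseteq> {..<n}" "\<forall>a. length a = n \<longrightarrow> f a = trm_val (env a) s"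
    "trm_pars t \<subseteq> A" "trm_vars t \<subseteq> {..<n}" "\<forall>a. length a = n \<longrightarrow> g a = trm_val (env a) t"
    unfolding term_fun_def by blast
  then show ?thesis unfolding term_fun_def by (intro exI[of _ "Add s t"]) auto
qed

lemma term_fun_mult:
  fixes R :: "'r \<Rightarrow> 'k::field list \<Rightarrow> bool"
  assumes "term_fun R A n f" "term_fun R A n g"
  shows "term_fun R A n (\<lambda>a. f a * g a)"
proof -
  from assms obtain s t :: "('r, 'k) trm" where
    "trm_pars s \<subseteq> A" "trm_vars s \<subseteq> {..<n}" "\<forall>a. length a = n \<longrightarrow> f a = trm_val (env a) s"
    "trm_pars t \<subseteq> A" "trm_vars t \<subseteq> {..<n}" "\<forall>a. length a = n \<longrightarrow> g a = trm_val (env a) t"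
    unfolding term_fun_def by blast
  then show ?thesis unfolding term_fun_def by (intro exI[of _ "Mul s t"]) auto
qed

lemma term_fun_uminus:
  fixes R :: "'r \<Rightarrow> 'k::field list \<Rightarrow> bool"
  assumes "term_fun R A n f"
  shows "term_fun R A n (\<lambda>a. - f a)"
proof -
  from assms obtain s :: "('r, 'k) trm" where
    "trm_pars s \<subseteq> A" "trm_vars s \<subseteq> {..<n}" "\<forall>a. length a = n \<longrightarrow> f a = trm_val (env a) s"
    unfolding term_fun_def by blast
  then show ?thesis unfolding term_fun_def by (intro exI[of _ "Minus s"]) auto
qed

lemma term_fun_diff:
  "term_fun R A n f \<Longrightarrow> term_fun R A n g \<Longrightarrow> term_fun R A n (\<lambda>a. f a - g a)"
  using term_fun_add[of R A n f "\<lambda>a. - g a"] term_fun_uminus[of R A n g] by simp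

lemma term_fun_power: "term_fun R A n f \<Longrightarrow> term_fun R A n (\<lambda>a. f a ^ k)"
  by (induction k) (auto intro: term_fun_1 term_fun_mult)

lemma term_fun_sum:
  "finite I \<Longrightarrow> (\<And>i. i \<in> I \<Longrightarrow> term_fun R A n (f i)) \<Longrightarrow> term_fun R A n (\<lambda>a. \<Sum>i\<in>I. f i a)"
  by (induction I rule: finite_induct) (auto intro: term_fun_0 term_fun_add)

lemmas term_fun_intros = term_fun_const term_fun_0 term_fun_1 term_fun_nth term_fun_add
  term_fun_mult term_fun_uminus term_fun_diff term_fun_power term_fun_sum

lemma term_map_Nil: "term_map R A n 0 (\<lambda>a. [])"
  unfolding term_map_def by auto

lemma term_map_append:
  fixes R :: "'r \<Rightarrow> 'k::field list \<Rightarrow> bool"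
  assumes "term_map R A n m g" "term_map R A n l h"
  shows "term_map R A n (m + l) (\<lambda>a. g a @ h a)"
proof -
  from assms obtain ts us :: "('r, 'k) trm list" where
    "length ts = m" "\<forall>t\<in>set ts. trm_pars t \<subseteq> A \<and> trm_vars t \<subseteq> {..<n}"
    "\<forall>a. length a = n \<longrightarrow> g a = map (trm_val (env a)) ts"
    "length us = l" "\<forall>t\<in>set us. trm_pars t \<subseteq> A \<and> trm_vars t \<subseteq> {..<n}"
    "\<forall>a. length a = n \<longrightarrow> h a = map (trm_val (env a)) us"
    unfolding term_map_def by blast
  then show ?thesis unfolding term_map_def by (intro exI[of _ "ts @ us"]) auto
qed

lemma term_map_Cons:
  fixes R :: "'r \<Rightarrow> 'k::field list \<Rightarrow> bool"
  assumes "term_fun R A n f" "term_map R A n m g"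
  shows "term_map R A n (Suc m) (\<lambda>a. f a # g a)"
proof -
  from assms obtain t :: "('r, 'k) trm" and us :: "('r, 'k) trm list" where
    "trm_pars t \<subseteq> A" "trm_vars t \<subseteq> {..<n}" "\<forall>a. length a = n \<longrightarrow> f a = trm_val (env a) t"
    "length us = m" "\<forall>t\<in>set us. trm_pars t \<subseteq> A \<and> trm_vars t \<subseteq> {..<n}"
    "\<forall>a. length a = n \<longrightarrow> g a = map (trm_val (env a)) us"
    unfolding term_map_def term_fun_def by blast
  then show ?thesis unfolding term_map_def by (intro exI[of _ "t # us"]) auto
qed

lemma term_map_drop: "k \<le> n \<Longrightarrow> term_map R A n (n - k) (drop k)"
  unfolding term_map_def
  by (intro exI[of _ "map Var [k..<n]"]) (auto intro!: nth_equalityI)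

lemma term_map_take: "k \<le> n \<Longrightarrow> term_map R A n k (take k)"
  unfolding term_map_def
  by (intro exI[of _ "map Var [0..<k]"]) (auto intro!: nth_equalityI)

lemma term_map_id: "term_map R A n n (\<lambda>a. a)"
  using term_map_drop[of 0 n R A] by (simp add: drop_0[abs_def])

lemma term_map_const: "set c \<subseteq> A \<Longrightarrow> term_map R A n (length c) (\<lambda>a. c)"
  by (induction c) (auto intro: term_map_Nil term_map_Cons term_fun_const)

lemma term_map_map:
  "(\<And>x. x \<in> set xs \<Longrightarrow> term_fun R A n (f x)) \<Longrightarrow>
    term_map R A n (length xs) (\<lambda>a. map (\<lambda>x. f x a) xs)"
  by (induction xs) (auto intro: term_map_Nil term_map_Cons)

lemma forms_mono: "A \<subseteq> B \<Longrightarrow> forms A n \<subseteq> forms B n"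
  unfolding forms_def by auto

lemma definable_mono: "definable R A n P \<Longrightarrow> A \<subseteq> B \<Longrightarrow> definable R B n P"
  unfolding definable_def using forms_mono[of A B n] by blast

lemma definable_cong:
  "definable R A n P \<Longrightarrow> (\<And>a. length a = n \<Longrightarrow> P a \<longleftrightarrow> Q a) \<Longrightarrow> definable R A n Q"
  unfolding definable_def by auto

lemma definable_holds: "\<phi> \<in> forms A n \<Longrightarrow> definable R A n (\<lambda>a. holds R a \<phi>)"
  unfolding definable_def by blast

lemma definable_Not: "definable R A n P \<Longrightarrow> definable R A n (\<lambda>a. \<not> P a)"
  unfolding definable_def forms_def holds_def
  by (elim bexE, rule_tac x = "Not \<phi>" in bexI) auto

lemma definable_conj:
  assumes "definable R A n P" "definable R A n Q"
  shows "definable R A n (\<lambda>a. P a \<and> Q a)"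
proof -
  from assms obtain \<phi> \<psi> where "\<phi> \<in> forms A n" "\<forall>a. length a = n \<longrightarrow> (P a \<longleftrightarrow> holds R a \<phi>)"
    "\<psi> \<in> forms A n" "\<forall>a. length a = n \<longrightarrow> (Q a \<longleftrightarrow> holds R a \<psi>)"
    unfolding definable_def by blast
  then show ?thesis unfolding definable_def forms_def holds_def
    by (intro bexI[of _ "And \<phi> \<psi>"]) auto
qed

lemma definable_eq:
  fixes R :: "'r \<Rightarrow> 'k::field list \<Rightarrow> bool"
  assumes "term_fun R A n f" "term_fun R A n g"
  shows "definable R A n (\<lambda>a. f a = g a)"
proof -
  from assms obtain s t :: "('r, 'k) trm" where
    "trm_pars s \<subseteq> A" "trm_vars s \<subseteq> {..<n}" "\<forall>a. length a = n \<longrightarrow> f a = trm_val (env a) s"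
    "trm_pars t \<subseteq> A" "trm_vars t \<subseteq> {..<n}" "\<forall>a. length a = n \<longrightarrow> g a = trm_val (env a) t"
    unfolding term_fun_def by blast
  then show ?thesis unfolding definable_def forms_def holds_def
    by (intro bexI[of _ "Eq s t"]) auto
qed

lemma definable_True: "definable R A n (\<lambda>a. True)"
  using definable_eq[OF term_fun_0 term_fun_0] by simp

lemma definable_ball:
  "finite I \<Longrightarrow> (\<And>i. i \<in> I \<Longrightarrow> definable R A n (P i)) \<Longrightarrow> definable R A n (\<lambda>a. \<forall>i\<in>I. P i a)"
  by (induction I rule: finite_induct) (auto intro: definable_True definable_conj)

lemma definable_bex:
  "finite I \<Longrightarrow> (\<And>i. i \<in> I \<Longrightarrow> definable R A n (P i)) \<Longrightarrow> definable R A n (\<lambda>a. \<exists>i\<in>I. P i a)"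
  using definable_Not[OF definable_ball[of I R A n "\<lambda>i a. \<not> P i a"]]
  by (simp add: definable_Not)

lemma definable_subst:
  fixes R :: "'r \<Rightarrow> 'k::field list \<Rightarrow> bool"
  assumes "definable R A m P" "term_map R A n m g"
  shows "definable R A n (\<lambda>a. P (g a))"
proof -
  from assms(1) obtain \<phi> where \<phi>: "\<phi> \<in> forms A m"
    "\<And>a. length a = m \<Longrightarrow> P a \<longleftrightarrow> holds R a \<phi>"
    unfolding definable_def by blast
  from assms(2) obtain ts :: "('r, 'k) trm list" where ts: "length ts = m"
    "\<forall>t\<in>set ts. trm_pars t \<subseteq> A \<and> trm_vars t \<subseteq> {..<n}"
    "\<And>a. length a = n \<Longrightarrow> g a = map (trm_val (env a)) ts"
    unfolding term_map_def by blast
  \<comment> \<open>\<open>Zero\<close> beyond \<open>m\<close> reproduces the default value 0 that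
    \<open>holds\<close> gives to variables past the end of a tuple.\<close>
  let ?\<sigma> = "\<lambda>i. if i < m then ts ! i else Zero"
  from fm_subst[where \<phi> = \<phi> and \<sigma> = ?\<sigma> and R = R] obtain \<phi>' where \<phi>':
    "free_vars \<phi>' \<subseteq> (\<Union>i\<in>free_vars \<phi>. trm_vars (?\<sigma> i))"
    "pars \<phi>' \<subseteq> pars \<phi> \<union> (\<Union>i\<in>free_vars \<phi>. trm_pars (?\<sigma> i))"
    "\<And>e. sat R e \<phi>' \<longleftrightarrow> sat R (\<lambda>i. trm_val e (?\<sigma> i)) \<phi>" by blast
  have tsn: "trm_pars (ts ! i) \<subseteq> A" "trm_vars (ts ! i) \<subseteq> {..<n}" if "i < m" for i
    using ts(1,2) that nth_mem[of i ts] by blast+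
  have "free_vars \<phi>' \<subseteq> {..<n}"
  proof
    fix v assume "v \<in> free_vars \<phi>'"
    with \<phi>'(1) obtain i where "v \<in> trm_vars (?\<sigma> i)" by auto
    then show "v \<in> {..<n}" using tsn(2)[of i] by (cases "i < m") auto
  qed
  moreover have "pars \<phi>' \<subseteq> A"
  proof
    fix c assume "c \<in> pars \<phi>'"
    with \<phi>'(2) consider "c \<in> pars \<phi>" | i where "c \<in> trm_pars (?\<sigma> i)" by auto
    then show "c \<in> A"
    proof cases
      case 1
      then show ?thesis using \<phi>(1) unfolding forms_def by auto
    next
      case (2 i)
      then show ?thesis using tsn(1)[of i] by (cases "i < m") auto
    qed
  qed
  moreover have "P (g a) \<longleftrightarrow> holds R a \<phi>'" if "length a = n" for a
    using that \<phi>(2)[of "g a"] unfolding holds_def \<phi>'(3)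
    by (auto simp: ts intro!: sat_cong)
  ultimately show ?thesis unfolding definable_def forms_def by blast
qed

lemma definable_ex:
  assumes "definable R A (Suc n) P"
  shows "definable R A n (\<lambda>a. \<exists>x. P (x # a))"
proof -
  \<comment> \<open>The quantified entry moves from the head to the last position, so that binding
    variable \<open>n\<close> leaves the indices of \<open>a\<close> unchanged.\<close>
  have "definable R A (Suc n) (\<lambda>a. P (a ! n # take n a))"
    by (rule definable_subst[OF assms])
      (intro term_map_Cons term_fun_nth term_map_take; simp)
  then obtain \<phi> where \<phi>: "\<phi> \<in> forms A (Suc n)"
    "\<And>a. length a = Suc n \<Longrightarrow> P (a ! n # take n a) \<longleftrightarrow> holds R a \<phi>"
    unfolding definable_def by blast
  have "P (x # a) \<longleftrightarrow> sat R ((env a)(n := x)) \<phi>" if "length a = n" for a x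
  proof -
    have "P (x # a) \<longleftrightarrow> holds R (a @ [x]) \<phi>"
      using \<phi>(2)[of "a @ [x]"] that by (simp add: nth_append)
    also have "\<dots> \<longleftrightarrow> sat R ((env a)(n := x)) \<phi>"
      unfolding holds_def using that by (intro sat_cong) (auto simp: nth_append)
    finally show ?thesis .
  qed
  then have "(\<exists>x. P (x # a)) \<longleftrightarrow> holds R a (Ex n \<phi>)" if "length a = n" for a
    using that unfolding holds_def by simp
  moreover have "Ex n \<phi> \<in> forms A n"
    using \<phi>(1) unfolding forms_def by (auto simp: less_Suc_eq)
  ultimately show ?thesis unfolding definable_def by blast
qed

lemma definable_all:
  assumes "definable R A (Suc n) P"
  shows "definable R A n (\<lambda>a. \<forall>x. P (x # a))"
  using definable_Not[OF definable_ex[OF definable_Not[OF assms]]] by simp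

lemma definable_ex_list:
  "definable R A (k + n) P \<Longrightarrow> definable R A n (\<lambda>a. \<exists>xs. length xs = k \<and> P (xs @ a))"
proof (induction k arbitrary: P)
  case (Suc k)
  then have "definable R A (k + n) (\<lambda>a. \<exists>x. P (x # a))"
    by (intro definable_ex) simp
  from Suc.IH[OF this] show ?case
    by (rule definable_cong) (force simp: length_Suc_conv)
qed simp

text \<open>Stability is a statement about formulas without parameters, and uniformity means varying
  the parameters; both require the parameters to be split off as a tuple \<open>c\<close>.\<close>

lemma definable_unpar:
  fixes R :: "'r \<Rightarrow> 'k::field list \<Rightarrow> bool"
  assumes "definable R A n P"
  shows "\<exists>c Q. set c \<subseteq> A \<and> definable R {} (n + length c) Q \<and>
    (\<forall>a. length a = n \<longrightarrow> (P a \<longleftrightarrow> Q (a @ c)))"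
proof -
  from assms obtain \<phi> where \<phi>: "\<phi> \<in> forms A n"
    "\<And>a. length a = n \<Longrightarrow> P a \<longleftrightarrow> holds R a \<phi>"
    unfolding definable_def by blast
  obtain c where c: "set c = pars \<phi>" "distinct c"
    using finite_distinct_list[of "pars \<phi>"] by auto
  obtain M where M: "\<And>f. \<forall>c. M \<le> f c \<Longrightarrow> \<exists>\<phi>'. pars \<phi>' = {} \<and>
    (\<forall>e. (\<forall>c\<in>pars \<phi>. e (f c) = c) \<longrightarrow> (sat R e \<phi>' \<longleftrightarrow> sat R e \<phi>))"
    using fm_unpar[of \<phi> R] by blast
  \<comment> \<open>The \<open>i\<close>-th parameter gets variable \<open>max M n + i\<close>:
    above \<open>M\<close> to escape capture, above \<open>n\<close> to avoid the variables of
    \<open>a\<close>. The substitution \<open>\<sigma>\<close> then moves it down to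
    \<open>n + i\<close>.\<close>
  define f where "f = (\<lambda>x. max M n + (if x \<in> set c then (THE i. i < length c \<and> c ! i = x) else 0))"
  have f_nth: "f (c ! i) = max M n + i" if "i < length c" for i
  proof -
    have "(THE j. j < length c \<and> c ! j = c ! i) = i"
      by (rule the_equality) (use that c(2) nth_eq_iff_index_eq in auto)
    then show ?thesis using that unfolding f_def by simp
  qed
  have "\<forall>x. M \<le> f x" unfolding f_def by auto
  from M[OF this] obtain \<psi> where \<psi>: "pars \<psi> = {}"
    "\<And>e. (\<forall>x\<in>pars \<phi>. e (f x) = x) \<Longrightarrow> sat R e \<psi> \<longleftrightarrow> sat R e \<phi>" by blast
  define \<sigma> :: "nat \<Rightarrow> ('r, 'k) trm" where
    "\<sigma> = (\<lambda>i. if i < n then Var i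
       else if max M n \<le> i \<and> i < max M n + length c then Var (n + (i - max M n)) else Zero)"
  from fm_subst[where \<phi> = \<psi> and \<sigma> = \<sigma> and R = R] obtain \<phi>' where \<phi>':
    "free_vars \<phi>' \<subseteq> (\<Union>i\<in>free_vars \<psi>. trm_vars (\<sigma> i))"
    "pars \<phi>' \<subseteq> pars \<psi> \<union> (\<Union>i\<in>free_vars \<psi>. trm_pars (\<sigma> i))"
    "\<And>e. sat R e \<phi>' \<longleftrightarrow> sat R (\<lambda>i. trm_val e (\<sigma> i)) \<psi>" by blast
  have "trm_vars (\<sigma> i) \<subseteq> {..<n + length c}" "trm_pars (\<sigma> i) = {}" for i
    unfolding \<sigma>_def by auto
  then have "\<phi>' \<in> forms {} (n + length c)"
    using \<phi>'(1,2) \<psi>(1) unfolding forms_def by blast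
  moreover have "P a \<longleftrightarrow> holds R (a @ c) \<phi>'" if a: "length a = n" for a
  proof -
    let ?e = "\<lambda>i. trm_val (env (a @ c)) (\<sigma> i)"
    have "?e (f x) = x" if "x \<in> pars \<phi>" for x
    proof -
      from that c obtain i where i: "i < length c" "x = c ! i" by (metis in_set_conv_nth)
      moreover have "\<not> max M n + i < n" by simp
      ultimately show ?thesis using a by (simp add: f_nth \<sigma>_def nth_append del: max_less_iff_conj)
    qed
    then have "holds R (a @ c) \<phi>' \<longleftrightarrow> sat R ?e \<phi>"
      unfolding holds_def \<phi>'(3) using \<psi>(2) by auto
    also have "\<dots> \<longleftrightarrow> holds R a \<phi>"
      unfolding holds_def using a \<phi>(1)
      by (intro sat_cong) (auto simp: forms_def \<sigma>_def nth_append)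
    finally show ?thesis using \<phi>(2)[OF a] by simp
  qed
  ultimately show ?thesis using c(1) \<phi>(1) definable_holds[of \<phi>' "{}" "n + length c" R]
    unfolding forms_def by (intro exI[of _ c] exI[of _ "\<lambda>a. holds R a \<phi>'"]) auto
qed

section \<open>Shattering\<close>

definition shattered :: "'a set set \<Rightarrow> 'a set \<Rightarrow> bool" where
  "shattered F S \<longleftrightarrow> (\<forall>T\<subseteq>S. \<exists>X\<in>F. X \<inter> S = T)"

lemma shattered_subset:
  assumes "shattered F S" "S' \<subseteq> S"
  shows "shattered F S'"
  unfolding shattered_def
proof (intro allI impI)
  fix T assume "T \<subseteq> S'"
  with assms obtain X where "X \<in> F" "X \<inter> S = T" unfolding shattered_def by blast
  with assms(2) \<open>T \<subseteq> S'\<close> show "\<exists>X\<in>F. X \<inter> S' = T" by blast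
qed

text \<open>Pajor's inequality, by induction on the ground set. Removing \<open>x\<close>, the
  members of \<open>F\<close> are counted by their traces \<open>F1\<close> plus the traces
  \<open>F2\<close> that arise twice. Whatever \<open>F1\<close> shatters, \<open>F\<close>
  shatters; whatever \<open>F2\<close> shatters, \<open>F\<close> shatters even with
  \<open>x\<close> added.\<close>

lemma card_le_card_shattered:
  assumes "finite A" "F \<subseteq> Pow A"
  shows "card F \<le> card {S. S \<subseteq> A \<and> shattered F S}"
  using assms
proof (induction A arbitrary: F rule: finite_induct)
  case empty
  have "card F \<le> 1" using empty card_mono[of "{{}}" F] by auto
  have "card F = 0 \<or> {S. S \<subseteq> {} \<and> shattered F S} = {{}}"
    by (cases "F = {}") (auto simp: shattered_def)
  then have "card F = 0 \<or> card {S. S \<subseteq> {} \<and> shattered F S} = 1"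
    by (elim disjE) (simp_all only: is_singletonI is_singleton_altdef[symmetric] simp_thms)
  with \<open>card F \<le> 1\<close> show ?case by linarith
next
  case (insert x A)
  define F1 where "F1 = (\<lambda>X. X - {x}) ` F"
  define F2 where "F2 = {X. X \<subseteq> A \<and> X \<in> F \<and> insert x X \<in> F}"
  have finF: "finite F" using insert.prems insert.hyps(1) finite_subset by blast
  have F1: "F1 \<subseteq> Pow A" and F2: "F2 \<subseteq> Pow A"
    using insert.prems unfolding F1_def F2_def by auto
  have fin: "finite F1" "finite F2"
    using F1 F2 insert.hyps(1) finite_subset by blast+
  have inj: "inj_on (insert x) (Pow A)"
  proof (rule inj_onI)
    fix X Y assume "X \<in> Pow A" "Y \<in> Pow A" "insert x X = insert x Y"
    moreover from this insert.hyps(2) have "x \<notin> X" "x \<notin> Y" by auto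
    ultimately show "X = Y" using insert_ident by metis
  qed
  have "card F = card F1 + card F2"
  proof -
    \<comment> \<open>Of two members of \<open>F\<close> with the same trace, \<open>?G\<close>
      contains the one with \<open>x\<close>; on the rest the trace is injective.\<close>
    let ?G = "insert x ` F2"
    have "F1 = (\<lambda>X. X - {x}) ` (F - ?G)"
    proof (intro equalityI subsetI)
      fix Y assume "Y \<in> F1"
      then obtain X where X: "X \<in> F" "Y = X - {x}" unfolding F1_def by auto
      show "Y \<in> (\<lambda>X. X - {x}) ` (F - ?G)"
      proof (cases "X \<in> ?G")
        case True
        then obtain Z where Z: "Z \<in> F2" "X = insert x Z" by auto
        moreover from Z(1) have "x \<notin> Z" using F2 insert.hyps(2) by auto
        ultimately have "Y \<in> F2" using X(2) by simp
        moreover have "x \<notin> Y" using X by auto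
        ultimately have "Y \<in> F - ?G" "Y = Y - {x}" unfolding F2_def by auto
        then show ?thesis by blast
      qed (use X in auto)
    qed (auto simp: F1_def)
    moreover have "inj_on (\<lambda>X. X - {x}) (F - ?G)"
    proof (intro inj_onI)
      fix X Y assume XY: "X \<in> F - ?G" "Y \<in> F - ?G" "X - {x} = Y - {x}"
      have *: "Z \<in> ?G" if "Z \<in> F" "Z - {x} \<in> F" "x \<in> Z" for Z
        using that insert.prems unfolding F2_def by (intro image_eqI[of _ _ "Z - {x}"]) (auto simp: insert_absorb)
      show "X = Y"
      proof (cases "x \<in> X"; cases "x \<in> Y")
        assume "x \<in> X" "x \<notin> Y"
        with XY * [of X] show ?thesis by auto
      next
        assume "x \<notin> X" "x \<in> Y"
        with XY * [of Y] show ?thesis by auto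
      qed (use XY in auto)
    qed
    ultimately have "card F1 = card (F - ?G)" by (simp add: card_image)
    moreover have "card ?G = card F2"
      by (rule card_image, rule inj_on_subset[OF inj F2])
    moreover have "?G \<subseteq> F" unfolding F2_def by auto
    ultimately show ?thesis
      using finF card_Diff_subset[of ?G F] card_mono[of F ?G] finite_subset[of ?G F] by auto
  qed
  also have "\<dots> \<le> card {S. S \<subseteq> A \<and> shattered F1 S} + card {S. S \<subseteq> A \<and> shattered F2 S}"
    using insert.IH[OF F1] insert.IH[OF F2] by simp
  also have "\<dots> = card {S. S \<subseteq> A \<and> shattered F1 S} +
      card (insert x ` {S. S \<subseteq> A \<and> shattered F2 S})"
    by (subst card_image[OF inj_on_subset[OF inj]]) auto
  also have "\<dots> = card ({S. S \<subseteq> A \<and> shattered F1 S} \<union> insert x ` {S. S \<subseteq> A \<and> shattered F2 S})"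
    by (rule card_Un_disjoint[symmetric]) (use insert.hyps in auto)
  also have "\<dots> \<le> card {S. S \<subseteq> insert x A \<and> shattered F S}"
  proof (rule card_mono)
    show "finite {S. S \<subseteq> insert x A \<and> shattered F S}" using insert.hyps(1) by simp
    have "shattered F S" if "S \<subseteq> A" "shattered F1 S" for S
      unfolding shattered_def
    proof (intro allI impI)
      fix T assume "T \<subseteq> S"
      with that(2) obtain X where "X \<in> F" "(X - {x}) \<inter> S = T"
        unfolding shattered_def F1_def by blast
      moreover have "x \<notin> S" using that insert.hyps(2) by auto
      ultimately show "\<exists>X\<in>F. X \<inter> S = T" by blast
    qed
    moreover have "shattered F (insert x S)" if "S \<subseteq> A" "shattered F2 S" for S
      unfolding shattered_def
    proof (intro allI impI)
      fix T assume T: "T \<subseteq> insert x S"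
      then have "T - {x} \<subseteq> S" by auto
      with that(2) obtain X where X: "X \<subseteq> A" "X \<in> F" "insert x X \<in> F" "X \<inter> S = T - {x}"
        unfolding shattered_def F2_def by blast
      show "\<exists>X\<in>F. X \<inter> insert x S = T"
        using X T insert.hyps(2)
        by (cases "x \<in> T") (intro bexI[of _ "insert x X"] bexI[of _ X]; auto)+
    qed
    ultimately show "{S. S \<subseteq> A \<and> shattered F1 S} \<union> insert x ` {S. S \<subseteq> A \<and> shattered F2 S}
        \<subseteq> {S. S \<subseteq> insert x A \<and> shattered F S}" by auto
  qed
  finally show ?case .
qed

text \<open>Lists of length \<open>d\<close>, padded by repeating an element, enumerate the nonempty
  subsets; the empty set has nothing to repeat and accounts for the \<open>+ 1\<close>.\<close>

lemma card_small_subsets: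
  assumes "finite A"
  shows "card {S. S \<subseteq> A \<and> card S \<le> d} \<le> card A ^ d + 1"
proof -
  have "{S. S \<subseteq> A \<and> card S \<le> d} \<subseteq> insert {} (set ` {xs. set xs \<subseteq> A \<and> length xs = d})"
  proof
    fix S assume "S \<in> {S. S \<subseteq> A \<and> card S \<le> d}"
    then have S: "S \<subseteq> A" "card S \<le> d" by auto
    then have "finite S" using assms finite_subset by blast
    then obtain xs where xs: "set xs = S" "distinct xs" using finite_distinct_list by blast
    show "S \<in> insert {} (set ` {xs. set xs \<subseteq> A \<and> length xs = d})"
    proof (cases "S = {}")
      case False
      then obtain s where "s \<in> S" by auto
      let ?ys = "xs @ replicate (d - length xs) s"
      have "length xs \<le> d" using xs S(2) distinct_card by fastforce
      then have "set ?ys = S" "length ?ys = d" using xs(1) \<open>s \<in> S\<close> by auto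
      then show ?thesis using S(1) by blast
    qed simp
  qed
  then have "card {S. S \<subseteq> A \<and> card S \<le> d} \<le> card (insert {} (set ` {xs. set xs \<subseteq> A \<and> length xs = d}))"
    using finite_lists_length_eq[OF assms, of d] by (intro card_mono finite.insertI finite_imageI) auto
  also have "\<dots> \<le> card (set ` {xs. set xs \<subseteq> A \<and> length xs = d}) + 1"
    using finite_imageI[OF finite_lists_length_eq[OF assms, of d], of set] by (simp add: card_insert_if)
  also have "\<dots> \<le> card {xs. set xs \<subseteq> A \<and> length xs = d} + 1"
    using card_image_le[OF finite_lists_length_eq[OF assms, of d], of set] by simp
  also have "\<dots> = card A ^ d + 1"
    using card_lists_length_eq[OF assms] by simp
  finally show ?thesis .
qed

text \<open>If no set of size \<open>d\<close> is shattered, all shattered sets have at most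
  \<open>d\<close> elements, because subsets of shattered sets are shattered. There are then too few
  of them for Pajor's inequality.\<close>

lemma sauer_shelah:
  assumes "finite A" "F \<subseteq> Pow A" "card F > card A ^ d + 1"
  shows "\<exists>S. S \<subseteq> A \<and> card S = d \<and> shattered F S"
proof (rule ccontr)
  assume no: "\<not> ?thesis"
  have "{S. S \<subseteq> A \<and> shattered F S} \<subseteq> {S. S \<subseteq> A \<and> card S \<le> d}"
  proof safe
    fix S assume S: "S \<subseteq> A" "shattered F S"
    show "card S \<le> d"
    proof (rule ccontr)
      assume "\<not> card S \<le> d"
      then obtain T where "T \<subseteq> S" "card T = d"
        using obtain_subset_with_card_n[of d S] by auto
      with no S shattered_subset show False by blast
    qed
  qed
  then have "card {S. S \<subseteq> A \<and> shattered F S} \<le> card {S. S \<subseteq> A \<and> card S \<le> d}"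
    using assms(1) by (intro card_mono) auto
  with card_le_card_shattered[OF assms(1,2)] card_small_subsets[OF assms(1), of d] assms(3) show False by simp
qed

section \<open>Separating many sets by few points\<close>

lemma averaging:
  assumes "finite P" "finite \<Omega>" "\<Omega> \<noteq> {}"
    and "\<And>p. p \<in> P \<Longrightarrow> \<epsilon> * real (card \<Omega>) \<le> real (card {w \<in> \<Omega>. T p w})"
  shows "\<exists>w\<in>\<Omega>. \<epsilon> * real (card P) \<le> real (card {p \<in> P. T p w})"
proof (rule ccontr)
  assume "\<not> ?thesis"
  then have less: "real (card {p \<in> P. T p w}) < \<epsilon> * real (card P)" if "w \<in> \<Omega>" for w
    using that by force
  \<comment> \<open>Double counting of the incidences \<open>T p w\<close>.\<close>
  have "real (card P) * (\<epsilon> * real (card \<Omega>)) \<le> (\<Sum>p\<in>P. real (card {w \<in> \<Omega>. T p w}))"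
    using sum_bounded_below[of P "\<epsilon> * real (card \<Omega>)" "\<lambda>p. real (card {w \<in> \<Omega>. T p w})"] assms(4)
    by simp
  also have "\<dots> = (\<Sum>p\<in>P. \<Sum>w\<in>\<Omega>. of_bool (T p w))"
    using assms(2) by (simp add: sum.If_cases of_bool_def Int_def)
  also have "\<dots> = (\<Sum>w\<in>\<Omega>. \<Sum>p\<in>P. of_bool (T p w))" by (rule sum.swap)
  also have "\<dots> = (\<Sum>w\<in>\<Omega>. real (card {p \<in> P. T p w}))"
    using assms(1) by (simp add: sum.If_cases of_bool_def Int_def)
  also have "\<dots> < (\<Sum>w\<in>\<Omega>. \<epsilon> * real (card P))"
    by (rule sum_strict_mono) (use assms(2,3) less in auto)
  finally show False by (simp add: mult_ac)
qed

text \<open>Greedy choice: by averaging, some point settles a proportion \<open>\<epsilon>\<close>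
  of the \<open>p\<close> still open, so each point multiplies their number by at most
  \<open>1 - \<epsilon>\<close>.\<close>

lemma separating_sample:
  assumes "finite P" "finite \<Omega>" "\<Omega> \<noteq> {}" "0 \<le> \<epsilon>" "\<epsilon> \<le> 1"
    and "\<And>p. p \<in> P \<Longrightarrow> \<epsilon> * real (card \<Omega>) \<le> real (card {w \<in> \<Omega>. T p w})"
  shows "\<exists>W\<subseteq>\<Omega>. card W \<le> m \<and>
    real (card {p \<in> P. \<forall>w\<in>W. \<not> T p w}) \<le> (1 - \<epsilon>) ^ m * real (card P)"
proof (induction m)
  case 0
  show ?case by (intro exI[of _ "{}"]) simp
next
  case (Suc m)
  then obtain W where W: "W \<subseteq> \<Omega>" "card W \<le> m"
    "real (card {p \<in> P. \<forall>w\<in>W. \<not> T p w}) \<le> (1 - \<epsilon>) ^ m * real (card P)" by auto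
  let ?Q = "{p \<in> P. \<forall>w\<in>W. \<not> T p w}"
  have "\<exists>w\<in>\<Omega>. \<epsilon> * real (card ?Q) \<le> real (card {p \<in> ?Q. T p w})"
    by (rule averaging) (use assms in auto)
  then obtain w where w: "w \<in> \<Omega>" "\<epsilon> * real (card ?Q) \<le> real (card {p \<in> ?Q. T p w})" by auto
  have "{p \<in> P. \<forall>w\<in>insert w W. \<not> T p w} = ?Q - {p \<in> ?Q. T p w}" by auto
  then have "real (card {p \<in> P. \<forall>w\<in>insert w W. \<not> T p w}) = real (card ?Q) - real (card {p \<in> ?Q. T p w})"
    using assms(1) by (simp only:) (subst card_Diff_subset; auto intro!: of_nat_diff card_mono)
  also have "\<dots> \<le> (1 - \<epsilon>) * real (card ?Q)" using w(2) by (simp add: algebra_simps)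
  also have "\<dots> \<le> (1 - \<epsilon>) * ((1 - \<epsilon>) ^ m * real (card P))"
    using W(3) assms(5) by (intro mult_left_mono) auto
  finally have "real (card {p \<in> P. \<forall>w\<in>insert w W. \<not> T p w}) \<le> (1 - \<epsilon>) ^ Suc m * real (card P)"
    by simp
  moreover have "card (insert w W) \<le> Suc m" using W(2) card_insert_le_m1[of "Suc m" W w] by simp
  ultimately show ?case using W(1) w(1) by (intro exI[of _ "insert w W"]) auto
qed

lemma poly_times_geometric:
  assumes "0 \<le> q" "q < (1::real)"
  shows "(\<lambda>m. real ((m ^ d + 2) ^ 2) * q ^ m) \<longlonglongrightarrow> 0"
proof -
  have *: "(\<lambda>m. real (m ^ k) * q ^ m) \<longlonglongrightarrow> 0" for k
  proof (cases "k = 0")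
    case True
    then show ?thesis using assms by (simp add: LIMSEQ_power_zero)
  next
    case False
    \<comment> \<open>\<open>m ^ k * q ^ m\<close> is the \<open>k\<close>-th power of
      \<open>m * root k q ^ m\<close>, which reduces the claim to a linear factor.\<close>
    then have "root k q < 1" "0 \<le> root k q"
      using assms real_root_less_mono[of k q 1] by auto
    then have "(\<lambda>m. (of_nat m * root k q ^ m) ^ k) \<longlonglongrightarrow> 0 ^ k"
      by (intro tendsto_power powser_times_n_limit_0) auto
    moreover have "(of_nat m * root k q ^ m) ^ k = real (m ^ k) * q ^ m" for m
    proof -
      have "(root k q ^ m) ^ k = (root k q ^ k) ^ m" by (simp only: power_mult[symmetric] mult.commute)
      then show ?thesis using False assms by (simp add: power_mult_distrib)
    qed
    ultimately show ?thesis using False by (simp add: zero_power)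
  qed
  have "(\<lambda>m. real (m ^ (2 * d)) * q ^ m + 4 * (real (m ^ d) * q ^ m) + 4 * q ^ m)
      \<longlonglongrightarrow> 0 + 4 * 0 + 4 * 0"
    using assms by (intro tendsto_add tendsto_mult tendsto_const * LIMSEQ_power_zero) simp
  then show ?thesis
    by (simp add: power2_eq_square algebra_simps power_mult_distrib power_mult[symmetric] mult_2_right power_add)
qed

text \<open>
  A random sample of size \<open>m\<close> fails to separate a given pair with probability at most
  \<open>(1 - \<epsilon>) ^ m\<close>, so a few points separate all the sets, more than the bound of Sauer and Shelah
  allows.
\<close>

lemma shattered_if_separated:
  fixes \<epsilon> :: real and d :: nat
  assumes "0 < \<epsilon>" "\<epsilon> \<le> 1"
  obtains M :: nat where
    "\<And>\<Omega> :: 'w set. \<And>E :: nat \<Rightarrow> 'w set. finite \<Omega> \<Longrightarrow>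
      (\<And>i j. i < M \<Longrightarrow> j < M \<Longrightarrow> i \<noteq> j \<Longrightarrow> \<epsilon> * real (card \<Omega>) \<le> real (card {w \<in> \<Omega>. w \<in> E i \<and> w \<notin> E j})) \<Longrightarrow>
      \<Omega> \<noteq> {} \<Longrightarrow> \<exists>S\<subseteq>\<Omega>. card S = d \<and> (\<forall>T\<subseteq>S. \<exists>i<M. E i \<inter> S = T)"
proof -
  have "eventually (\<lambda>m. real ((m ^ d + 2) ^ 2) * (1 - \<epsilon>) ^ m < 1) sequentially"
    using poly_times_geometric[of "1 - \<epsilon>" d] assms by (intro order_tendstoD) auto
  then obtain m where m: "real ((m ^ d + 2) ^ 2) * (1 - \<epsilon>) ^ m < 1"
    using eventually_happens'[OF sequentially_bot] by blast
  \<comment> \<open>One more than the bound \<open>m ^ d + 1\<close> for a sample of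
    \<open>m\<close> points. There are at most \<open>?M ^ 2\<close> ordered pairs to separate,
    whence the choice of \<open>m\<close>.\<close>
  let ?M = "m ^ d + 2"
  show ?thesis
  proof (rule that[of ?M])
    fix \<Omega> :: "'w set" and E :: "nat \<Rightarrow> 'w set"
    assume \<Omega>: "finite \<Omega>" "\<Omega> \<noteq> {}" and E: "\<And>i j. i < ?M \<Longrightarrow> j < ?M \<Longrightarrow> i \<noteq> j \<Longrightarrow>
      \<epsilon> * real (card \<Omega>) \<le> real (card {w \<in> \<Omega>. w \<in> E i \<and> w \<notin> E j})"
    let ?P = "{(i, j). i < ?M \<and> j < ?M \<and> i \<noteq> j}"
    let ?T = "\<lambda>(i, j) w. w \<in> E i \<and> w \<notin> E j"
    have sub: "?P \<subseteq> {..<?M} \<times> {..<?M}" by auto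
    then have finP: "finite ?P" by (rule finite_subset) auto
    have "card ?P \<le> ?M ^ 2"
      using card_mono[OF _ sub] by (simp add: power2_eq_square)
    obtain W where W: "W \<subseteq> \<Omega>" "card W \<le> m"
      "real (card {p \<in> ?P. \<forall>w\<in>W. \<not> ?T p w}) \<le> (1 - \<epsilon>) ^ m * real (card ?P)"
      using separating_sample[of ?P \<Omega> \<epsilon> ?T m] finP \<Omega> assms E by fastforce
    have "(1 - \<epsilon>) ^ m * real (card ?P) \<le> (1 - \<epsilon>) ^ m * real (?M ^ 2)"
      using \<open>card ?P \<le> ?M ^ 2\<close> assms by (intro mult_left_mono) (auto simp del: of_nat_power)
    also have "\<dots> < 1" using m by (simp add: mult.commute)
    \<comment> \<open>A cardinality below 1 is 0, so every pair is separated and the traces on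
      \<open>W\<close> are distinct.\<close>
    finally have "card {p \<in> ?P. \<forall>w\<in>W. \<not> ?T p w} = 0" using W(3) by simp
    then have none: "{p \<in> ?P. \<forall>w\<in>W. \<not> ?T p w} = {}" using finP by simp
    define F where "F = (\<lambda>i. E i \<inter> W) ` {..<?M}"
    have "inj_on (\<lambda>i. E i \<inter> W) {..<?M}"
    proof (intro inj_onI)
      fix i j assume ij: "i \<in> {..<?M}" "j \<in> {..<?M}" "E i \<inter> W = E j \<inter> W"
      show "i = j"
      proof (rule ccontr)
        assume "i \<noteq> j"
        with ij none have "\<exists>w\<in>W. w \<in> E i \<and> w \<notin> E j" by auto
        with ij(3) show False by blast
      qed
    qed
    then have "card F = ?M" unfolding F_def by (simp add: card_image)
    moreover have "card W ^ d \<le> m ^ d" using W(2) by (rule power_mono) simp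
    ultimately have "card F > card W ^ d + 1" by simp
    from sauer_shelah[OF finite_subset[OF W(1) \<Omega>(1)] _ this]
    obtain S where S: "S \<subseteq> W" "card S = d" "shattered F S"
      unfolding F_def by auto
    have "\<exists>i<?M. E i \<inter> S = T" if "T \<subseteq> S" for T
    proof -
      from S(3) that obtain X where "X \<in> F" "X \<inter> S = T" unfolding shattered_def by blast
      then obtain i where "i < ?M" "X = E i \<inter> W" unfolding F_def by auto
      moreover have "E i \<inter> S = T" using \<open>X = E i \<inter> W\<close> \<open>X \<inter> S = T\<close> S(1) by blast
      ultimately show ?thesis by blast
    qed
    with S(1,2) W(1) show "\<exists>S\<subseteq>\<Omega>. card S = d \<and> (\<forall>T\<subseteq>S. \<exists>i<?M. E i \<inter> S = T)" by blast
  qed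
qed

section \<open>Generic sets\<close>

text \<open>With the number of translates bounded in advance, covering the field becomes a
  first-order condition on the parameters of \<open>X\<close>.\<close>

definition ngen :: "nat \<Rightarrow> 'k::field set \<Rightarrow> bool" where
  "ngen N X \<longleftrightarrow> (\<exists>S. finite S \<and> card S \<le> N \<and> (\<forall>x. \<exists>s\<in>S. x - s \<in> X))"

lemma generic_set_iff:
  fixes X :: "'k::field set"
  shows "generic_set X \<longleftrightarrow> (\<exists>S. finite S \<and> (\<forall>x. \<exists>s\<in>S. x - s \<in> X))"
proof -
  have "(\<Union>s\<in>S. (\<lambda>x. s + x) ` X) = UNIV \<longleftrightarrow> (\<forall>x. \<exists>s\<in>S. x - s \<in> X)" for S :: "'k set"
  proof -
    have "x \<in> (\<lambda>x. s + x) ` X \<longleftrightarrow> x - s \<in> X" for x s :: 'k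
      by (auto simp: image_iff algebra_simps intro: bexI[of _ "x - s"])
    then show ?thesis by blast
  qed
  then show ?thesis unfolding generic_set_def by simp
qed

lemma ngenI: "finite S \<Longrightarrow> card S \<le> N \<Longrightarrow> (\<And>x. \<exists>s\<in>S. x - s \<in> X) \<Longrightarrow> ngen N X"
  unfolding ngen_def by (intro exI[of _ S] conjI allI)

lemma not_ngen_point:
  assumes "\<not> ngen N X" "finite S" "card S \<le> N"
  shows "\<exists>x. \<forall>s\<in>S. x - s \<notin> X"
proof (rule ccontr)
  assume "\<not> ?thesis"
  then have "ngen N X" by (intro ngenI[OF assms(2,3)]) simp
  with assms(1) show False ..
qed

lemma generic_set_iff_ngen: "generic_set X \<longleftrightarrow> (\<exists>N. ngen N X)"
  unfolding generic_set_iff ngen_def by auto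

lemma generic_setI: "finite S \<Longrightarrow> (\<And>x. \<exists>s\<in>S. x - s \<in> X) \<Longrightarrow> generic_set (X :: 'k::field set)"
  unfolding generic_set_iff by (intro exI[of _ S] conjI allI)

lemma generic_setE:
  fixes X :: "'k::field set"
  assumes "generic_set X"
  obtains S where "finite S" "\<forall>x. \<exists>s\<in>S. x - s \<in> X"
proof -
  from assms[unfolded generic_set_iff] obtain S where "finite S \<and> (\<forall>x. \<exists>s\<in>S. x - s \<in> X)" ..
  then show ?thesis by (intro that[of S]) simp_all
qed

lemma generic_set_mono:
  fixes X Y :: "'k::field set"
  assumes "generic_set X" "X \<subseteq> Y"
  shows "generic_set Y"
proof -
  obtain S where S: "finite S" "\<forall>x. \<exists>s\<in>S. x - s \<in> X"
    using generic_setE[OF assms(1)] .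
  from S(2) assms(2) have "\<exists>s\<in>S. x - s \<in> Y" for x by (meson subsetD)
  with S(1) show ?thesis by (rule generic_setI)
qed

lemma generic_set_empty: "\<not> generic_set ({} :: 'k::field set)"
  unfolding generic_set_iff by simp

lemma generic_set_UNIV: "generic_set (UNIV :: 'k::field set)"
  unfolding generic_set_iff by (auto intro: exI[of _ "{0}"])

text \<open>Translates of translates are translates, by the sums \<open>t + s\<close>.\<close>

lemma generic_set_translates:
  fixes X :: "'k::field set"
  assumes "finite S" "generic_set {x. \<exists>s\<in>S. x - s \<in> X}"
  shows "generic_set X"
proof -
  obtain T where T: "finite T" "\<forall>x. \<exists>t\<in>T. x - t \<in> {x. \<exists>s\<in>S. x - s \<in> X}"
    using generic_setE[OF assms(2)] .
  show ?thesis
  proof (rule generic_setI)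
    show "finite ((\<lambda>(t, s). t + s) ` (T \<times> S))" using T(1) assms(1) by simp
    fix x
    from T(2)[rule_format, of x] obtain t s where "t \<in> T" "s \<in> S" "x - (t + s) \<in> X"
      by (auto simp: diff_diff_eq)
    then show "\<exists>r\<in>(\<lambda>(t, s). t + s) ` (T \<times> S). x - r \<in> X" by auto
  qed
qed

lemma infinite_if_generic:
  assumes "infinite (UNIV :: 'k::field set)" "generic_set (X :: 'k set)"
  shows "infinite X"
proof
  assume "finite X"
  obtain S where S: "finite S" "\<forall>x. \<exists>s\<in>S. x - s \<in> X"
    using generic_setE[OF assms(2)] .
  have "x \<in> (\<lambda>(s, y). s + y) ` (S \<times> X)" for x
  proof -
    from S(2) obtain s where "s \<in> S" "x - s \<in> X" by blast
    then show ?thesis by (intro image_eqI[of _ _ "(s, x - s)"]) auto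
  qed
  then have "UNIV \<subseteq> (\<lambda>(s, y). s + y) ` (S \<times> X)" by blast
  with S(1) \<open>finite X\<close> have "finite (UNIV :: 'k set)"
    using finite_subset by blast
  with assms(1) show False by simp
qed

text \<open>A list of fixed length can be quantified over by \<open>definable_ex_list\<close>.
  Padding with 0 is harmless since an additional translate cannot spoil a covering.\<close>

lemma ngen_iff_list:
  assumes "0 < N"
  shows "ngen N X \<longleftrightarrow> (\<exists>ss. length ss = N \<and> (\<forall>x. \<exists>j<N. x - ss ! j \<in> X))"
proof
  assume "ngen N X"
  then obtain S where S: "finite S" "card S \<le> N" "\<And>x. \<exists>s\<in>S. x - s \<in> X"
    unfolding ngen_def by blast
  obtain xs where xs: "set xs = S" "length xs = card S"
    using finite_distinct_list[OF S(1)] distinct_card by metis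
  let ?ss = "xs @ replicate (N - length xs) 0"
  have "\<exists>j<N. x - ?ss ! j \<in> X" for x
  proof -
    from S(3)[of x] xs(1) obtain j where "j < length xs" "x - xs ! j \<in> X"
      by (metis in_set_conv_nth)
    then show ?thesis using xs(2) S(2) by (intro exI[of _ j]) (auto simp: nth_append)
  qed
  moreover have "length ?ss = N" using xs(2) S(2) by simp
  ultimately show "\<exists>ss. length ss = N \<and> (\<forall>x. \<exists>j<N. x - ss ! j \<in> X)" by blast
next
  assume "\<exists>ss. length ss = N \<and> (\<forall>x. \<exists>j<N. x - ss ! j \<in> X)"
  then obtain ss where ss: "length ss = N" "\<forall>x. \<exists>j<N. x - ss ! j \<in> X" by blast
  have "\<forall>x. \<exists>s\<in>set ss. x - s \<in> X"
  proof
    fix x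
    from ss obtain j where "j < length ss" "x - ss ! j \<in> X" by blast
    then show "\<exists>s\<in>set ss. x - s \<in> X" using nth_mem by blast
  qed
  then show "ngen N X" unfolding ngen_def using card_length[of ss] ss(1) by blast
qed

lemma ngen_0: "\<not> ngen 0 (X :: 'k::field set)"
  unfolding ngen_def by auto

lemma definable_ngen:
  fixes R :: "'r \<Rightarrow> 'k::field list \<Rightarrow> bool"
  assumes "definable R A (Suc m) Q"
  shows "definable R A m (\<lambda>b. ngen N {x. Q (x # b)})"
proof (cases "N = 0")
  case True
  then show ?thesis using definable_Not[OF definable_True] by (simp add: ngen_0)
next
  case False
  \<comment> \<open>The tuple consists of the point to be covered, then the \<open>N\<close>
    translating elements, then \<open>b\<close>.\<close>
  have "definable R A (Suc (N + m)) (\<lambda>a. \<exists>j\<in>{..<N}. Q ((a ! 0 - a ! Suc j) # drop (Suc N) a))"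
  proof (intro definable_bex definable_subst[OF assms] term_map_Cons term_fun_intros)
    show "term_map R A (Suc (N + m)) m (drop (Suc N))"
      using term_map_drop[of "Suc N" "Suc (N + m)" R A] by simp
  qed auto
  then have "definable R A (N + m) (\<lambda>a. \<forall>x. \<exists>j\<in>{..<N}. Q ((x - a ! j) # drop N a))"
    using definable_all by fastforce
  then have "definable R A m (\<lambda>b. \<exists>ss. length ss = N \<and>
      (\<forall>x. \<exists>j\<in>{..<N}. Q ((x - (ss @ b) ! j) # drop N (ss @ b))))"
    by (rule definable_ex_list)
  then show ?thesis
    using False by (elim definable_cong) (simp add: ngen_iff_list nth_append, fastforce)
qed

section \<open>Definable subsets of the field\<close>

definition dset :: "('r \<Rightarrow> 'k::field list \<Rightarrow> bool) \<Rightarrow> 'k set \<Rightarrow> bool" where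
  "dset R X \<longleftrightarrow> definable R UNIV 1 (\<lambda>a. a ! 0 \<in> X)"

lemma dset_fibre:
  assumes "definable R A (Suc (length b)) Q"
  shows "dset R {x. Q (x # b)}"
proof -
  have "definable R UNIV 1 (\<lambda>a. Q (a ! 0 # b))"
    by (intro definable_subst[OF definable_mono[OF assms]] term_map_Cons term_fun_nth term_map_const)
      auto
  then show ?thesis unfolding dset_def by simp
qed

lemma dset_subst:
  assumes "dset R X" "term_fun R UNIV 1 (\<lambda>a. f (a ! 0))"
  shows "dset R {x. f x \<in> X}"
proof -
  have "definable R UNIV 1 (\<lambda>a. [f (a ! 0)] ! 0 \<in> X)"
    using assms(1) unfolding dset_def
    by (rule definable_subst)
      (use term_map_Cons[OF assms(2) term_map_Nil] in simp)
  then show ?thesis unfolding dset_def by simp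
qed

lemma dset_translate: "dset R X \<Longrightarrow> dset R {x. x - s \<in> X}"
  by (erule dset_subst) (intro term_fun_intros; simp)

lemma dset_Compl: "dset R X \<Longrightarrow> dset R (- X)"
  unfolding dset_def using definable_Not by fastforce

lemma dset_Int: "dset R X \<Longrightarrow> dset R Y \<Longrightarrow> dset R (X \<inter> Y)"
  unfolding dset_def using definable_conj by fastforce

lemma dset_UN: "finite I \<Longrightarrow> (\<And>i. i \<in> I \<Longrightarrow> dset R (X i)) \<Longrightarrow> dset R (\<Union>i\<in>I. X i)"
  unfolding dset_def using definable_bex[of I R UNIV 1 "\<lambda>i a. a ! 0 \<in> X i"] by simp

lemma dset_INT: "finite I \<Longrightarrow> (\<And>i. i \<in> I \<Longrightarrow> dset R (X i)) \<Longrightarrow> dset R (\<Inter>i\<in>I. X i)"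
  unfolding dset_def using definable_ball[of I R UNIV 1 "\<lambda>i a. a ! 0 \<in> X i"] by simp

lemma dset_unpar:
  assumes "dset R X"
  obtains c Q where "definable R {} (Suc (length c)) Q" "X = {x. Q (x # c)}"
proof -
  from definable_unpar[OF assms[unfolded dset_def]] obtain c Q where
    "definable R {} (1 + length c) Q" "\<And>a. length a = 1 \<Longrightarrow> a ! 0 \<in> X \<longleftrightarrow> Q (a @ c)" by auto
  from this(1) this(2)[of "[x]" for x] show ?thesis by (intro that[of c Q]) auto
qed

subsection \<open>Finite additive subgroups\<close>

definition subgr :: "'k::field set \<Rightarrow> bool" where
  "subgr H \<longleftrightarrow> 0 \<in> H \<and> (\<forall>x\<in>H. \<forall>y\<in>H. x - y \<in> H)"

lemma subgr_add: "subgr H \<Longrightarrow> x \<in> H \<Longrightarrow> y \<in> H \<Longrightarrow> x + y \<in> H"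
  unfolding subgr_def by (metis diff_0 diff_minus_eq_add)

lemma subgr_diff: "subgr H \<Longrightarrow> x \<in> H \<Longrightarrow> y \<in> H \<Longrightarrow> x - y \<in> H"
  unfolding subgr_def by blast

lemma finite_range_of_int:
  assumes "CHAR('k::field) > 0"
  shows "finite (range (of_int :: int \<Rightarrow> 'k))"
proof -
  let ?p = "int CHAR('k)"
  have "(of_int x :: 'k) \<in> of_int ` {0..<?p}" for x
  proof -
    have "(of_int x :: 'k) = of_int (x div ?p * ?p + x mod ?p)" by simp
    also have "\<dots> = of_int (x mod ?p)" by (simp only: of_int_add of_int_mult) simp
    finally show ?thesis using assms by auto
  qed
  then have "range (of_int :: int \<Rightarrow> 'k) \<subseteq> of_int ` {0..<?p}" by auto
  then show ?thesis by (rule finite_subset) simp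
qed

text \<open>Adjoining \<open>s\<close> to a finite subgroup \<open>H\<close> gives the sums of
  elements of \<open>H\<close> and prime field multiples of \<open>s\<close>; the prime field
  \<open>range of_int\<close> is finite in positive characteristic.\<close>

lemma ex_finite_subgr:
  assumes "CHAR('k::field) > 0" "finite (S :: 'k set)"
  shows "\<exists>H. finite H \<and> subgr H \<and> S \<subseteq> H"
  using assms(2)
proof (induction S rule: finite_induct)
  case empty
  show ?case by (intro exI[of _ "{0}"]) (simp add: subgr_def)
next
  case (insert s S)
  then obtain H where H: "finite H" "subgr H" "S \<subseteq> H" by blast
  let ?H = "(\<lambda>(h, c). h + c * s) ` (H \<times> range of_int)"
  have "finite ?H" using H(1) finite_range_of_int[OF assms(1)] by auto
  moreover have "subgr ?H"
    unfolding subgr_def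
  proof (intro conjI ballI)
    show "0 \<in> ?H" using H(2) unfolding subgr_def
      by (intro image_eqI[of _ _ "(0, of_int 0)"]) (auto intro: range_eqI[of _ _ 0])
    fix x y assume "x \<in> ?H" "y \<in> ?H"
    then obtain h i g j where "h \<in> H" "g \<in> H" "x = h + of_int i * s" "y = g + of_int j * s" by auto
    moreover from this have "x - y = (h - g) + of_int (i - j) * s" by (simp add: algebra_simps)
    ultimately show "x - y \<in> ?H" using subgr_diff[OF H(2)]
      by (intro image_eqI[of _ _ "(h - g, of_int (i - j))"]) (auto simp del: of_int_diff)
  qed
  moreover have "s \<in> ?H" using H(2) unfolding subgr_def
    by (intro image_eqI[of _ _ "(0, of_int 1)"]) (auto intro: range_eqI[of _ _ 1])
  moreover have "h \<in> ?H" if "h \<in> H" for h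
    using that by (intro image_eqI[of _ _ "(h, of_int 0)"]) (auto intro: range_eqI[of _ _ 0])
  ultimately show ?case using H(3) by (intro exI[of _ ?H]) auto
qed

text \<open>Because \<open>T\<close> lies in \<open>H\<close>, the covering takes place inside
  \<open>H\<close>, and \<open>G\<close> has density at least \<open>1 / card T\<close>
  there.\<close>

lemma subgr_cover:
  assumes "finite H" "subgr H" "finite T" "T \<subseteq> H" "\<And>x. x \<in> H \<Longrightarrow> \<exists>t\<in>T. x - t \<in> G"
  shows "card H \<le> card T * card (H \<inter> G)"
proof -
  have "H \<subseteq> (\<lambda>(t, x). t + x) ` (T \<times> (H \<inter> G))"
  proof
    fix x assume x: "x \<in> H"
    with assms(5) obtain t where t: "t \<in> T" "x - t \<in> G" by blast
    then show "x \<in> (\<lambda>(t, x). t + x) ` (T \<times> (H \<inter> G))"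
      using x assms(4) subgr_diff[OF assms(2)] by (intro image_eqI[of _ _ "(t, x - t)"]) auto
  qed
  then have "card H \<le> card ((\<lambda>(t, x). t + x) ` (T \<times> (H \<inter> G)))"
    using assms by (intro card_mono) auto
  also have "\<dots> \<le> card (T \<times> (H \<inter> G))" using assms by (intro card_image_le) auto
  finally show ?thesis by (simp add: card_cartesian_product)
qed

text \<open>
  The density of an \<open>n\<close>-generic set in a large finite subgroup is at least \<open>1 / n\<close>.
\<close>

lemma ngen_not_inconsistent:
  fixes X :: "nat \<Rightarrow> 'k::field set"
  assumes "CHAR('k) > 0" "\<And>i. ngen n (X i)"
  shows "\<exists>I. finite I \<and> card I = k \<and> (\<exists>x. \<forall>i\<in>I. x \<in> X i)"
proof (rule ccontr)
  assume no: "\<not> ?thesis"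
  \<comment> \<open>\<open>N\<close> sets of density at least \<open>1 / n\<close> cover a point of
    \<open>H\<close> at least \<open>N / n\<close> times on average, and \<open>N / n\<close>
    exceeds \<open>k\<close>.\<close>
  define N where "N = n * k + 1"
  have "\<exists>S. finite S \<and> card S \<le> n \<and> (\<forall>x. \<exists>s\<in>S. x - s \<in> X i)" for i
    using assms(2)[of i] unfolding ngen_def .
  then obtain S where S: "\<And>i. finite (S i)" "\<And>i. card (S i) \<le> n"
    "\<And>i x. \<exists>s\<in>S i. x - s \<in> X i" by metis
  obtain H where H: "finite H" "subgr H" "(\<Union>i<N. S i) \<subseteq> H"
    using ex_finite_subgr[OF assms(1), of "\<Union>i<N. S i"] S(1) by auto
  have "card H > 0" using H(1,2) unfolding subgr_def by (auto simp: card_gt_0_iff)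
  have "card H \<le> n * card (H \<inter> X i)" if "i < N" for i
  proof -
    have "card H \<le> card (S i) * card (H \<inter> X i)"
      by (rule subgr_cover) (use H S that in auto)
    also have "\<dots> \<le> n * card (H \<inter> X i)" using S(2) by (intro mult_right_mono) auto
    finally show ?thesis .
  qed
  then have "N * card H \<le> (\<Sum>i<N. n * card (H \<inter> X i))"
    using sum_bounded_below[of "{..<N}" "card H" "\<lambda>i. n * card (H \<inter> X i)"] by simp
  also have "\<dots> = n * (\<Sum>i<N. \<Sum>h\<in>H. of_bool (h \<in> X i))"
    using H(1) by (simp add: sum_distrib_left of_bool_def sum.If_cases Int_def)
  also have "\<dots> = n * (\<Sum>h\<in>H. \<Sum>i<N. of_bool (h \<in> X i))" by (subst sum.swap) (rule refl)
  also have "\<dots> = n * (\<Sum>h\<in>H. card {i. i < N \<and> h \<in> X i})"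
    by (simp add: of_bool_def sum.If_cases Int_def lessThan_def)
  also have "\<dots> \<le> n * (\<Sum>h\<in>H. k)"
  proof (intro mult_left_mono sum_mono)
    fix h
    show "card {i. i < N \<and> h \<in> X i} \<le> k"
    proof (rule ccontr)
      assume "\<not> ?thesis"
      then obtain I where I: "I \<subseteq> {i. i < N \<and> h \<in> X i}" "card I = k"
        using obtain_subset_with_card_n[of k "{i. i < N \<and> h \<in> X i}"] by auto
      then have "finite I" using finite_subset[of I "{..<N}"] by auto
      with I no show False by blast
    qed
  qed simp
  finally have "N * card H \<le> n * k * card H" by (simp add: mult_ac)
  then show False using \<open>card H > 0\<close> unfolding N_def by simp
qed

subsection \<open>Generic sets in stable fields\<close>

locale stable_field =
  fixes R :: "'r \<Rightarrow> 'k::field list \<Rightarrow> bool"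
  assumes inf: "infinite (UNIV :: 'k set)"
    and stab: "stable R"
    and char_pos: "CHAR('k) > 0"
begin

lemma order_bound:
  assumes "definable R {} (n + m) P"
  obtains N :: nat where "\<not> (\<exists>a b. (\<forall>i<N. length (a i) = n \<and> length (b i) = m) \<and>
    (\<forall>i<N. \<forall>j<N. P (a i @ b j) \<longleftrightarrow> i < j))"
proof -
  from assms obtain \<phi> where \<phi>: "\<phi> \<in> forms {} (n + m)"
    "\<And>a. length a = n + m \<Longrightarrow> P a \<longleftrightarrow> holds R a \<phi>"
    unfolding definable_def by blast
  from stab[unfolded stable_def, rule_format, OF \<phi>(1)] obtain N :: nat where
    N: "\<not> (\<exists>a b. (\<forall>i<N. length (a i) = n \<and> length (b i) = m) \<and>
      (\<forall>i<N. \<forall>j<N. holds R (a i @ b j) \<phi> \<longleftrightarrow> i < j))" ..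
  show ?thesis
  proof (rule that[of N], rule notI, elim exE conjE)
    fix a b assume ab: "\<forall>i<N. length (a i) = n \<and> length (b i) = m"
      "\<forall>i<N. \<forall>j<N. P (a i @ b j) \<longleftrightarrow> i < j"
    then have "\<forall>i<N. \<forall>j<N. holds R (a i @ b j) \<phi> \<longleftrightarrow> i < j"
      using \<phi>(2) by simp
    with ab(1) have "\<exists>a b. (\<forall>i<N. length (a i) = n \<and> length (b i) = m) \<and>
      (\<forall>i<N. \<forall>j<N. holds R (a i @ b j) \<phi> \<longleftrightarrow> i < j)"
      by (intro exI[of _ a] exI[of _ b] conjI)
    with N show False ..
  qed
qed

text \<open>If neither set is \<open>N\<close>-generic, any \<open>N\<close> translates of either
  leave a point uncovered. Such points extend an order for \<open>Q (x + y, b)\<close> step by step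
  up to length \<open>N\<close>, the bound given by stability. The bound is uniform because
  \<open>b\<close> is part of the second tuple.\<close>

lemma dichotomy_uniform:
  assumes "definable R {} (Suc m) Q"
  obtains N where "\<forall>b. length b = m \<longrightarrow> ngen N {x. Q (x # b)} \<or> ngen N {x. \<not> Q (x # b)}"
proof -
  have "definable R {} (1 + Suc m) (\<lambda>a. Q ((a ! 0 + a ! 1) # drop 2 a))"
  proof (intro definable_subst[OF assms] term_map_Cons term_fun_intros)
    show "term_map R {} (1 + Suc m) m (drop 2)"
      using term_map_drop[of 2 "1 + Suc m" R "{}"] by simp
  qed auto
  from order_bound[OF this] obtain N :: nat where
    N: "\<not> (\<exists>a b. (\<forall>i<N. length (a i) = 1 \<and> length (b i) = Suc m) \<and>
    (\<forall>i<N. \<forall>j<N. Q (((a i @ b j) ! 0 + (a i @ b j) ! 1) # drop 2 (a i @ b j)) \<longleftrightarrow> i < j))" .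
  show ?thesis
  proof (rule that[of N], intro allI impI, rule ccontr)
    fix b :: "'k list"
    assume b: "length b = m" and no: "\<not> (ngen N {x. Q (x # b)} \<or> ngen N {x. \<not> Q (x # b)})"
    have pos: "\<exists>y. \<forall>s\<in>S. Q ((y - s) # b)" if "finite S" "card S \<le> N" for S
      using not_ngen_point[of N "{x. \<not> Q (x # b)}" S] no that by simp
    have neg: "\<exists>y. \<forall>s\<in>S. \<not> Q ((y - s) # b)" if "finite S" "card S \<le> N" for S
      using not_ngen_point[of N "{x. Q (x # b)}" S] no that by simp
    have "\<exists>a c. \<forall>i<n. \<forall>j<n. Q ((a i + c j) # b) \<longleftrightarrow> i < j" if "n \<le> N" for n
      using that
    proof (induction n)
      case (Suc n)
      then obtain a c where ac: "\<forall>i<n. \<forall>j<n. Q ((a i + c j) # b) \<longleftrightarrow> i < j" by auto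
      \<comment> \<open>First \<open>y\<close> is chosen outside the translates of the complement by
        the \<open>- a i\<close>, then \<open>z\<close> outside those of the set by all
        \<open>- ?c j\<close>, with \<open>y\<close> itself included: this makes the diagonal entry
        false, as \<open>i < j\<close> demands.\<close>
      have "card ((\<lambda>i. - a i) ` {..<n}) \<le> N"
        using Suc.prems card_image_le[of "{..<n}" "\<lambda>i. - a i"] by simp
      from pos[OF _ this] obtain y where y: "\<forall>i<n. Q ((a i + y) # b)"
        by (auto simp: add.commute)
      let ?c = "c(n := y)"
      have "card ((\<lambda>i. - ?c i) ` {..n}) \<le> N"
        using Suc.prems card_image_le[of "{..n}" "\<lambda>i. - ?c i"] by simp
      from neg[OF _ this] obtain z where z: "\<forall>j\<le>n. \<not> Q ((z + ?c j) # b)" by auto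
      have "\<forall>i<Suc n. \<forall>j<Suc n. Q (((a(n := z)) i + ?c j) # b) \<longleftrightarrow> i < j"
      proof (intro allI impI)
        fix i j assume "i < Suc n" "j < Suc n"
        then consider "i = n" "j \<le> n" | "i < n" "j = n" | "i < n" "j < n" by linarith
        then show "Q (((a(n := z)) i + ?c j) # b) \<longleftrightarrow> i < j"
        proof cases
          case 1
          then show ?thesis using z by simp
        next
          case 2
          then show ?thesis using y by simp
        next
          case 3
          then show ?thesis using ac by simp
        qed
      qed
      then show ?case by blast
    qed simp
    from this[of N] obtain a c where "\<forall>i<N. \<forall>j<N. Q ((a i + c j) # b) \<longleftrightarrow> i < j" by blast
    with b have "\<exists>a c. (\<forall>i<N. length (a i) = 1 \<and> length (c i) = Suc m) \<and>
      (\<forall>i<N. \<forall>j<N. Q (((a i @ c j) ! 0 + (a i @ c j) ! 1) # drop 2 (a i @ c j)) \<longleftrightarrow> i < j)"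
      by (intro exI[of _ "\<lambda>i. [a i]"] exI[of _ "\<lambda>j. c j # b"]) simp
    with N show False ..
  qed
qed

lemma generic_or_Compl:
  assumes "dset R X"
  shows "generic_set X \<or> generic_set (- X)"
proof -
  from dset_unpar[OF assms] obtain c Q where
    cQ: "definable R {} (Suc (length c)) Q" "X = {x. Q (x # c)}" .
  obtain N where "\<forall>b. length b = length c \<longrightarrow> ngen N {x. Q (x # b)} \<or> ngen N {x. \<not> Q (x # b)}"
    using dichotomy_uniform[OF cQ(1)] .
  from this[rule_format, of c] show ?thesis
    unfolding generic_set_iff_ngen cQ(2) Collect_neg_eq by auto
qed

text \<open>
  If \<open>X\<close> and its complement were generic, the sets \<open>{(v, w). u * v + w \<in> X}\<close> for distinct \<open>u\<close>
  would be pairwise independent events of probability bounded away from \<open>0\<close> and \<open>1\<close>, hence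
  pairwise far apart, which the bounded order length forbids.
\<close>

lemma generic_Compl_not_generic:
  assumes X: "dset R X" "generic_set X"
  shows "\<not> generic_set (- X)"
proof
  assume "generic_set (- X)"
  from generic_setE[OF this] obtain S2 where
    S2: "finite S2" "\<forall>x. \<exists>s\<in>S2. x - s \<in> - X" .
  from generic_setE[OF X(2)] obtain S1 where
    S1: "finite S1" "\<forall>x. \<exists>s\<in>S1. x - s \<in> X" .
  \<comment> \<open>One set of translating elements serves both \<open>X\<close> and its complement,
    hence one \<open>n\<close>.\<close>
  define S where "S = S1 \<union> S2"
  have S: "finite S" "\<forall>x. \<exists>s\<in>S. x - s \<in> X" "\<And>x. \<exists>s\<in>S. x - s \<in> - X"
    unfolding S_def using S1 S2 by (auto simp del: Compl_iff)
  define n where "n = card S"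
  have "S \<noteq> {}" using S(2) by blast
  then have "n > 0" using S(1) unfolding n_def by (simp add: card_gt_0_iff)
  from dset_unpar[OF X(1)] obtain c Q where
    cQ: "definable R {} (Suc (length c)) Q" "X = {x. Q (x # c)}" .
  have "definable R {} (1 + (2 + length c)) (\<lambda>a. Q ((a ! 0 * a ! 1 + a ! 2) # drop 3 a))"
  proof (intro definable_subst[OF cQ(1)] term_map_Cons term_fun_intros)
    show "term_map R {} (1 + (2 + length c)) (length c) (drop 3)"
      using term_map_drop[of 3 "1 + (2 + length c)" R "{}"] by simp
  qed auto
  from order_bound[OF this] obtain d :: nat where
    d: "\<not> (\<exists>a b. (\<forall>i<d. length (a i) = 1 \<and> length (b i) = 2 + length c) \<and>
    (\<forall>i<d. \<forall>j<d. Q (((a i @ b j) ! 0 * (a i @ b j) ! 1 + (a i @ b j) ! 2) # drop 3 (a i @ b j))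
      \<longleftrightarrow> i < j))" .
  \<comment> \<open>One factor \<open>1 / n\<close> comes from \<open>u i * v + w\<close> lying in
    \<open>X\<close>, the other, with that value fixed, from \<open>u j * v + w\<close> lying
    outside.\<close>
  define \<epsilon> where "\<epsilon> = 1 / real (n ^ 2)"
  have \<epsilon>: "0 < \<epsilon>" "\<epsilon> \<le> 1" using \<open>n > 0\<close> unfolding \<epsilon>_def by auto
  obtain M :: nat where M: "\<And>\<Omega> :: ('k \<times> 'k) set. \<And>E :: nat \<Rightarrow> ('k \<times> 'k) set. finite \<Omega> \<Longrightarrow>
      (\<And>i j. i < M \<Longrightarrow> j < M \<Longrightarrow> i \<noteq> j \<Longrightarrow>
        \<epsilon> * real (card \<Omega>) \<le> real (card {w \<in> \<Omega>. w \<in> E i \<and> w \<notin> E j})) \<Longrightarrow>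
      \<Omega> \<noteq> {} \<Longrightarrow> \<exists>S\<subseteq>\<Omega>. card S = d \<and> (\<forall>T\<subseteq>S. \<exists>i<M. E i \<inter> S = T)"
    using shattered_if_separated[OF \<epsilon>, of d] by blast
  obtain u :: "nat \<Rightarrow> 'k" where u: "inj u" using infinite_countable_subset[OF inf] by blast
  \<comment> \<open>Shifting \<open>v\<close> by \<open>s / (u j - u i)\<close> shifts
    \<open>(u j - u i) * v\<close> by \<open>s\<close>. With these quotients in \<open>V\<close>,
    the complement can be counted along \<open>V\<close>.\<close>
  have "finite ((\<lambda>(i, j, s). s / (u j - u i)) ` ({..<M} \<times> {..<M} \<times> S))" using S(1) by simp
  from ex_finite_subgr[OF char_pos this] obtain V where V: "finite V" "subgr V"
    "(\<lambda>(i, j, s). s / (u j - u i)) ` ({..<M} \<times> {..<M} \<times> S) \<subseteq> V" by blast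
  \<comment> \<open>\<open>W\<close> contains \<open>S\<close>, so that \<open>X\<close> can be
    counted in it, and all \<open>u i * v\<close>, so that
    \<open>(v, w) \<mapsto> (u i * v + w, v)\<close> is a bijection from \<open>V \<times> W\<close>
    to \<open>W \<times> V\<close>.\<close>
  have "finite (S \<union> (\<lambda>(i, v). u i * v) ` ({..<M} \<times> V))" using S(1) V(1) by simp
  from ex_finite_subgr[OF char_pos this] obtain W where W: "finite W" "subgr W"
    "S \<subseteq> W" "(\<lambda>(i, v). u i * v) ` ({..<M} \<times> V) \<subseteq> W" by blast
  define E where "E = (\<lambda>i. {(v, w). u i * v + w \<in> X})"
  have sep: "\<epsilon> * real (card (V \<times> W)) \<le> real (card {p \<in> V \<times> W. p \<in> E i \<and> p \<notin> E j})"
    if ij: "i < M" "j < M" "i \<noteq> j" for i j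
  proof -
    define \<delta> where "\<delta> = u j - u i"
    have "\<delta> \<noteq> 0" using u ij(3) unfolding \<delta>_def by (auto dest: injD)
    \<comment> \<open>In terms of \<open>y = u i * v + w\<close> the other value is
      \<open>u j * v + w = y + \<delta> * v\<close>.\<close>
    define G where "G = (\<lambda>y. {v. y + \<delta> * v \<in> - X})"
    have "card V \<le> n * card (V \<inter> G y)" for y
    proof -
      have "card V \<le> card ((\<lambda>s. s / \<delta>) ` S) * card (V \<inter> G y)"
      proof (rule subgr_cover)
        show "(\<lambda>s. s / \<delta>) ` S \<subseteq> V" using V(3) ij unfolding \<delta>_def by force
        fix v
        from S(3)[of "y + \<delta> * v"] obtain s where s: "s \<in> S" "y + \<delta> * v - s \<in> - X" by blast
        moreover have "y + \<delta> * (v - s / \<delta>) = y + \<delta> * v - s"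
          using \<open>\<delta> \<noteq> 0\<close> by (simp add: right_diff_distrib)
        ultimately have "s \<in> S" "v - s / \<delta> \<in> G y"
          unfolding G_def by (simp_all add: add_diff_eq)
        then show "\<exists>t\<in>(\<lambda>s. s / \<delta>) ` S. v - t \<in> G y" by blast
      qed (use V S(1) in auto)
      also have "\<dots> \<le> n * card (V \<inter> G y)"
        using card_image_le[OF S(1)] unfolding n_def by (intro mult_right_mono) auto
      finally show ?thesis .
    qed
    moreover have WX: "card W \<le> n * card (W \<inter> X)"
      unfolding n_def by (rule subgr_cover) (use W S in auto)
    ultimately have "card V * card W \<le> n * (\<Sum>y\<in>W \<inter> X. n * card (V \<inter> G y))"
    proof -
      have "card V * card W \<le> n * (card (W \<inter> X) * card V)"
        using mult_left_mono[OF WX, of "card V"] by (simp add: mult_ac)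
      also have "\<dots> \<le> n * (\<Sum>y\<in>W \<inter> X. n * card (V \<inter> G y))"
        using sum_bounded_below[of "W \<inter> X" "card V" "\<lambda>y. n * card (V \<inter> G y)"]
          \<open>\<And>y. card V \<le> n * card (V \<inter> G y)\<close> by (intro mult_left_mono) auto
      finally show ?thesis .
    qed
    also have "\<dots> = n ^ 2 * (\<Sum>y\<in>W \<inter> X. card (V \<inter> G y))"
      by (simp add: sum_distrib_left power2_eq_square mult_ac)
    also have "(\<Sum>y\<in>W \<inter> X. card (V \<inter> G y)) = card (SIGMA y:W \<inter> X. V \<inter> G y)"
      using W(1) V(1) by (intro card_SigmaI[symmetric]) auto
    also have "\<dots> = card {p \<in> V \<times> W. p \<in> E i \<and> p \<notin> E j}"
    proof (rule bij_betw_same_card)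
      let ?f = "\<lambda>(y, v). (v, y - u i * v)" and ?g = "\<lambda>(v, w). (u i * v + w, v)"
      have uv: "u i * v \<in> W" if "v \<in> V" for v using W(4) that ij(1) by force
      show "bij_betw ?f (SIGMA y:W \<inter> X. V \<inter> G y) {p \<in> V \<times> W. p \<in> E i \<and> p \<notin> E j}"
      proof (rule bij_betw_byWitness[where f' = ?g])
        show "?f ` (SIGMA y:W \<inter> X. V \<inter> G y) \<subseteq> {p \<in> V \<times> W. p \<in> E i \<and> p \<notin> E j}"
          using uv subgr_diff[OF W(2)] unfolding E_def G_def \<delta>_def
          by (auto simp: algebra_simps)
        show "?g ` {p \<in> V \<times> W. p \<in> E i \<and> p \<notin> E j} \<subseteq> (SIGMA y:W \<inter> X. V \<inter> G y)"
          using uv subgr_add[OF W(2)] unfolding E_def G_def \<delta>_def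
          by (auto simp: algebra_simps)
      qed auto
    qed
    finally have "real (card V * card W) \<le> real (n ^ 2 * card {p \<in> V \<times> W. p \<in> E i \<and> p \<notin> E j})"
      by (simp only: of_nat_le_iff)
    then show ?thesis
      using \<open>n > 0\<close> unfolding \<epsilon>_def by (simp add: card_cartesian_product field_simps)
  qed
  have "V \<times> W \<noteq> {}" using V(2) W(2) unfolding subgr_def by auto
  then have "\<exists>T\<subseteq>V \<times> W. card T = d \<and> (\<forall>T'\<subseteq>T. \<exists>i<M. E i \<inter> T = T')"
    using V(1) W(1) by (intro M[OF _ sep]) simp_all
  then obtain T where T: "card T = d" "T \<subseteq> V \<times> W" "\<forall>T'\<subseteq>T. \<exists>i<M. E i \<inter> T = T'"
    by (elim exE conjE)
  have "finite T" using T(2) V(1) W(1) finite_subset by blast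
  then obtain h where h: "bij_betw h {0..<d} T" using ex_bij_betw_nat_finite T(1) by blast
  \<comment> \<open>The final segments of the enumeration \<open>h\<close> are among the traces on
    the shattered set; they form an order of length \<open>d\<close>.\<close>
  have "\<exists>i. E i \<inter> T = h ` {k<..<d}" for k
  proof -
    have "h ` {k<..<d} \<subseteq> T" using h unfolding bij_betw_def by auto
    from T(3)[rule_format, OF this] show ?thesis by (elim exE conjE) (rule exI)
  qed
  then obtain I where I: "\<And>k. E (I k) \<inter> T = h ` {k<..<d}" by metis
  have iff: "u (I k) * fst (h j) + snd (h j) \<in> X \<longleftrightarrow> k < j" if "k < d" "j < d" for k j
  proof -
    have "u (I k) * fst (h j) + snd (h j) \<in> X \<longleftrightarrow> h j \<in> E (I k)"
      unfolding E_def by (simp add: case_prod_beta)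
    also have "\<dots> \<longleftrightarrow> h j \<in> h ` {k<..<d}"
      using I[of k] that(2) h unfolding bij_betw_def by auto
    also have "\<dots> \<longleftrightarrow> k < j"
      using h that unfolding bij_betw_def by (auto dest: inj_onD)
    finally show ?thesis .
  qed
  have "\<exists>a b. (\<forall>i<d. length (a i) = 1 \<and> length (b i) = 2 + length c) \<and>
    (\<forall>i<d. \<forall>j<d. Q (((a i @ b j) ! 0 * (a i @ b j) ! 1 + (a i @ b j) ! 2) # drop 3 (a i @ b j))
      \<longleftrightarrow> i < j)"
    using iff unfolding cQ(2)
    by (intro exI[of _ "\<lambda>k. [u (I k)]"] exI[of _ "\<lambda>j. fst (h j) # snd (h j) # c"]) simp
  with d show False ..
qed

text \<open>A set that is not \<open>N\<close>-generic has a generic complement by the dichotomy, so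
  is not generic. Genericity thus becomes definable in \<open>b\<close>.\<close>

lemma generic_uniform:
  assumes "definable R {} (Suc m) Q"
  obtains N where "\<forall>b. length b = m \<longrightarrow> generic_set {x. Q (x # b)} \<longleftrightarrow> ngen N {x. Q (x # b)}"
proof -
  obtain N where N: "\<forall>b. length b = m \<longrightarrow> ngen N {x. Q (x # b)} \<or> ngen N {x. \<not> Q (x # b)}"
    using dichotomy_uniform[OF assms] .
  show ?thesis
  proof (rule that[of N], intro allI impI)
    fix b :: "'k list" assume b: "length b = m"
    with assms have "dset R {x. Q (x # b)}" by (intro dset_fibre) simp
    from generic_Compl_not_generic[OF this] N[rule_format, OF b]
    show "generic_set {x. Q (x # b)} \<longleftrightarrow> ngen N {x. Q (x # b)}"
      unfolding generic_set_iff_ngen Collect_neg_eq by auto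
  qed
qed

text \<open>If \<open>Y\<close> is not generic, neither is a finite union of its translates, so the
  complement of that union is generic; it is covered by translates of \<open>X\<close>.\<close>

lemma generic_Un:
  assumes "dset R X" "dset R Y" "generic_set (X \<union> Y)"
  shows "generic_set X \<or> generic_set Y"
proof (rule disjCI)
  assume nY: "\<not> generic_set Y"
  from generic_setE[OF assms(3)] obtain S where
    S: "finite S" "\<forall>x. \<exists>s\<in>S. x - s \<in> X \<union> Y" .
  let ?Y = "{x. \<exists>s\<in>S. x - s \<in> Y}"
  have "dset R (\<Union>s\<in>S. {x. x - s \<in> Y})"
    using S(1) assms(2) by (intro dset_UN dset_translate)
  moreover have "(\<Union>s\<in>S. {x. x - s \<in> Y}) = ?Y" by blast
  ultimately have dY: "dset R ?Y" by simp
  have "\<not> generic_set ?Y" using nY generic_set_translates[OF S(1)] by (rule contrapos_nn)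
  then have "generic_set (- ?Y)" using generic_or_Compl[OF dY] by argo
  moreover have "- ?Y \<subseteq> {x. \<exists>s\<in>S. x - s \<in> X}" using S(2) by blast
  ultimately have "generic_set {x. \<exists>s\<in>S. x - s \<in> X}" by (rule generic_set_mono)
  then show "generic_set X" by (rule generic_set_translates[OF S(1)])
qed

lemma generic_UN:
  "finite I \<Longrightarrow> (\<And>i. i \<in> I \<Longrightarrow> dset R (X i)) \<Longrightarrow> generic_set (\<Union>i\<in>I. X i) \<Longrightarrow>
    \<exists>i\<in>I. generic_set (X i)"
proof (induction I rule: finite_induct)
  case empty
  then show ?case by (simp add: generic_set_empty)
next
  case (insert j I)
  then have "generic_set (X j) \<or> generic_set (\<Union>i\<in>I. X i)"
    by (intro generic_Un dset_UN) auto
  with insert show ?case by auto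
qed

text \<open>One of \<open>X \<inter> Y\<close> and \<open>X \<inter> - Y\<close> is generic, and the
  second would make \<open>- Y\<close> generic.\<close>

lemma generic_Int:
  assumes "dset R X" "dset R Y" "generic_set X" "generic_set Y"
  shows "generic_set (X \<inter> Y)"
proof -
  have "X = (X \<inter> Y) \<union> (X \<inter> - Y)" by blast
  with assms have "generic_set (X \<inter> Y) \<or> generic_set (X \<inter> - Y)"
    by (intro generic_Un dset_Int dset_Compl) auto
  moreover have "\<not> generic_set (X \<inter> - Y)"
    using generic_Compl_not_generic[OF assms(2,4)] generic_set_mono[of "X \<inter> - Y" "- Y"] by blast
  ultimately show ?thesis by blast
qed

lemma generic_INT:
  "finite I \<Longrightarrow> (\<And>i. i \<in> I \<Longrightarrow> dset R (X i)) \<Longrightarrow> (\<And>i. i \<in> I \<Longrightarrow> generic_set (X i)) \<Longrightarrow>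
    generic_set (\<Inter>i\<in>I. X i)"
  by (induction I rule: finite_induct)
    (auto intro!: generic_Int dset_INT simp: generic_set_UNIV)

end

section \<open>Generic types do not fork\<close>


lemma tp_eq_definable:
  assumes "tp R A a = tp R A b" "length a = length b" "definable R A (length b) P"
  shows "P a \<longleftrightarrow> P b"
proof -
  from assms(3) obtain \<phi> where \<phi>: "\<phi> \<in> forms A (length b)"
    "\<And>a. length a = length b \<Longrightarrow> P a \<longleftrightarrow> holds R a \<phi>"
    unfolding definable_def by blast
  have "P a \<longleftrightarrow> \<phi> \<in> tp R A a" using \<phi> assms(2) unfolding tp_def by simp
  also have "\<dots> \<longleftrightarrow> P b" unfolding assms(1) using \<phi> unfolding tp_def by simp
  finally show ?thesis .
qed

definition generic_elt :: "('r \<Rightarrow> 'k::field list \<Rightarrow> bool) \<Rightarrow> 'k set \<Rightarrow> 'k \<Rightarrow> bool" where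
  "generic_elt R A x \<longleftrightarrow> (\<forall>\<phi>\<in>forms A 1. holds R [x] \<phi> \<longrightarrow> generic_set {y. holds R [y] \<phi>})"

lemma generic_elt_mono: "generic_elt R B x \<Longrightarrow> A \<subseteq> B \<Longrightarrow> generic_elt R A x"
  unfolding generic_elt_def using forms_mono[of A B 1] by blast

lemma generic_eltD:
  assumes "generic_elt R A x" "definable R A 1 P" "P [x]"
  shows "generic_set {y. P [y]}"
proof -
  from assms(2) obtain \<phi> where \<phi>: "\<phi> \<in> forms A 1"
    "\<And>a. length a = 1 \<Longrightarrow> P a \<longleftrightarrow> holds R a \<phi>"
    unfolding definable_def by blast
  with assms(1,3) have "generic_set {y. holds R [y] \<phi>}" unfolding generic_elt_def by simp
  with \<phi>(2) show ?thesis by simp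
qed

definition gentype :: "('r \<Rightarrow> 'k::field list \<Rightarrow> bool) \<Rightarrow> 'k set \<Rightarrow> ('r, 'k) fm set" where
  "gentype R A = {\<phi> \<in> forms A 1. generic_set {x. holds R [x] \<phi>}}"

lemma forms_Not: "\<phi> \<in> forms A n \<Longrightarrow> Not \<phi> \<in> forms A n"
  unfolding forms_def by simp

lemma holds_Not: "holds R a (Not \<phi>) \<longleftrightarrow> \<not> holds R a \<phi>"
  unfolding holds_def by simp

lemma dset_definable: "definable R A 1 P \<Longrightarrow> dset R {x. P [x]}"
  using dset_fibre[of R A "[]" P] by simp

lemma dset_form: "\<phi> \<in> forms A 1 \<Longrightarrow> dset R {x. holds R [x] \<phi>}"
  by (rule dset_definable[OF definable_holds])

context stable_field
begin

lemma gentype_Not: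
  assumes "\<phi> \<in> forms A 1"
  shows "Not \<phi> \<in> gentype R A \<longleftrightarrow> \<phi> \<notin> gentype R A"
proof -
  have "{x. holds R [x] (Not \<phi>)} = - {x. holds R [x] \<phi>}" by (auto simp: holds_Not)
  then show ?thesis
    using generic_or_Compl[OF dset_form[OF assms]] generic_Compl_not_generic[OF dset_form[OF assms]]
      assms forms_Not[OF assms]
    unfolding gentype_def by auto
qed

lemma complete_gentype: "complete_type R A 1 (gentype R A)"
  unfolding complete_type_def
proof (intro conjI allI impI ballI)
  show "gentype R A \<subseteq> forms A 1" unfolding gentype_def by auto
next
  fix F assume F: "finite F \<and> F \<subseteq> gentype R A"
  then have "generic_set (\<Inter>\<phi>\<in>F. {x. holds R [x] \<phi>})"
    by (intro generic_INT dset_form) (auto simp: gentype_def)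
  then have "(\<Inter>\<phi>\<in>F. {x. holds R [x] \<phi>}) \<noteq> {}" using generic_set_empty by metis
  then obtain x where "\<forall>\<phi>\<in>F. holds R [x] \<phi>" by auto
  then show "\<exists>a. length a = 1 \<and> (\<forall>\<phi>\<in>F. holds R a \<phi>)" by (intro exI[of _ "[x]"]) simp
next
  fix \<phi> :: "('r, 'k) fm" assume "\<phi> \<in> forms A 1"
  from gentype_Not[OF this] show "\<phi> \<in> gentype R A \<or> Not \<phi> \<in> gentype R A" by blast
qed

text \<open>Resolves the definite description in \<open>field_weight\<close>. Any generic type is
  contained in \<open>gentype\<close>, and being complete it cannot be smaller.\<close>

lemma the_generic_type: "(THE p. generic_type R A p) = gentype R A"
proof (rule the_equality)
  show "generic_type R A (gentype R A)"
    unfolding generic_type_def using complete_gentype by (auto simp: gentype_def)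
next
  fix p assume p: "generic_type R A p"
  then have sub: "p \<subseteq> gentype R A"
    unfolding generic_type_def complete_type_def gentype_def by auto
  moreover have "\<phi> \<in> p" if \<phi>: "\<phi> \<in> gentype R A" for \<phi>
  proof (rule ccontr)
    assume "\<phi> \<notin> p"
    moreover have "\<phi> \<in> forms A 1" using \<phi> unfolding gentype_def by auto
    ultimately have "Not \<phi> \<in> gentype R A"
      using p sub unfolding generic_type_def complete_type_def by auto
    with gentype_Not[OF \<open>\<phi> \<in> forms A 1\<close>] \<phi> show False by blast
  qed
  ultimately show "p = gentype R A" by blast
qed

lemma generic_elt_iff_tp: "generic_elt R A x \<longleftrightarrow> tp R A [x] = gentype R A"
proof
  assume x: "generic_elt R A x"
  have "\<phi> \<in> tp R A [x] \<longleftrightarrow> \<phi> \<in> gentype R A" if \<phi>: "\<phi> \<in> forms A 1" for \<phi>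
  proof
    assume "\<phi> \<in> tp R A [x]"
    with x show "\<phi> \<in> gentype R A"
      unfolding tp_def gentype_def generic_elt_def by auto
  next
    assume g: "\<phi> \<in> gentype R A"
    show "\<phi> \<in> tp R A [x]"
    proof (rule ccontr)
      assume "\<phi> \<notin> tp R A [x]"
      then have "holds R [x] (Not \<phi>)" using \<phi> unfolding tp_def by (simp add: holds_Not)
      with x forms_Not[OF \<phi>] have "Not \<phi> \<in> gentype R A"
        unfolding generic_elt_def gentype_def by auto
      with gentype_Not[OF \<phi>] g show False by blast
    qed
  qed
  then show "tp R A [x] = gentype R A" unfolding tp_def gentype_def by auto
next
  assume "tp R A [x] = gentype R A"
  then show "generic_elt R A x" unfolding generic_elt_def tp_def gentype_def by auto
qed

text \<open>
  Being \<open>n\<close>-generic is a property of the type of the parameters \<open>b\<close> over \<open>A\<close>, so the conjugates of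
  an \<open>n\<close>-generic set are \<open>n\<close>-generic for the same \<open>n\<close>, hence not \<open>k\<close>-inconsistent.
\<close>

lemma generic_not_divides:
  assumes "set el \<subseteq> A" "\<phi> \<in> forms {} (Suc (length el) + length b)"
    and "generic_set {x. holds R (x # el @ b) \<phi>}"
  shows "\<not> divides R A (Suc (length el)) \<phi> b"
proof
  assume "divides R A (Suc (length el)) \<phi> b"
  then obtain k and f :: "nat \<Rightarrow> 'k list" where f0:
    "\<forall>i. length (f i) = length b \<and> tp R A (f i) = tp R A b" and f1:
    "\<forall>I. finite I \<and> card I = k \<longrightarrow>
      \<not> (\<exists>a. length a = Suc (length el) \<and> (\<forall>i\<in>I. holds R (a @ f i) \<phi>))"
    unfolding divides_def by (elim exE conjE)
  from f0 have f: "tp R A (f i) = tp R A b" "length (f i) = length b" for i by simp_all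
  obtain n where n: "ngen n {x. holds R (x # el @ b) \<phi>}"
    using assms(3) unfolding generic_set_iff_ngen by auto
  \<comment> \<open>\<open>el\<close> lies in \<open>A\<close> and is inserted as constants, so only
    \<open>b\<close> varies with the conjugates.\<close>
  have "definable R A (Suc (length b)) (\<lambda>a. holds R (a ! 0 # el @ drop 1 a) \<phi>)"
  proof (rule definable_subst)
    show "definable R A (Suc (length el + length b)) (\<lambda>a. holds R a \<phi>)"
      using definable_mono[OF definable_holds[OF assms(2)]] by simp
    show "term_map R A (Suc (length b)) (Suc (length el + length b)) (\<lambda>a. a ! 0 # el @ drop 1 a)"
      using assms(1) term_map_drop[of 1 "Suc (length b)" R A]
      by (intro term_map_Cons term_map_append term_map_const term_fun_nth) auto
  qed
  then have "definable R A (length b) (\<lambda>y. ngen n {x. holds R (x # el @ y) \<phi>})"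
    using definable_ngen by fastforce
  from tp_eq_definable[OF f this] n have "ngen n {x. holds R (x # el @ f i) \<phi>}" for i by simp
  from ngen_not_inconsistent[of n "\<lambda>i. {x. holds R (x # el @ f i) \<phi>}" k, OF char_pos this]
  obtain I x where
    "finite I" "card I = k" "\<forall>i\<in>I. holds R (x # el @ f i) \<phi>" by auto
  then have "\<exists>a. length a = Suc (length el) \<and> (\<forall>i\<in>I. holds R (a @ f i) \<phi>)"
    by (intro exI[of _ "x # el"]) simp
  with f1[rule_format, of I] \<open>finite I\<close> \<open>card I = k\<close> show False by blast
qed

text \<open>The fixed part \<open>el\<close> is there because the members of the weight witness have
  this shape. Fibres over \<open>el\<close> of formulas in the type are generic, as are their finite
  intersections, so if finitely many dividing formulas covered one, some of them would have a
  generic fibre.\<close>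

lemma generic_not_forks:
  assumes "generic_elt R C c" "set el \<subseteq> A" "A \<subseteq> C"
  shows "\<not> forks R A (Suc (length el)) (tp R C (c # el))"
proof
  assume "forks R A (Suc (length el)) (tp R C (c # el))"
  then obtain F D where FD: "finite F" "F \<subseteq> tp R C (c # el)" "finite D"
    and D: "\<forall>(\<phi>, b)\<in>D. \<phi> \<in> forms {} (Suc (length el) + length b) \<and>
      divides R A (Suc (length el)) \<phi> b"
    and cover: "\<forall>a. length a = Suc (length el) \<and> (\<forall>\<psi>\<in>F. holds R a \<psi>) \<longrightarrow>
      (\<exists>(\<phi>, b)\<in>D. holds R (a @ b) \<phi>)"
    unfolding forks_def by (elim exE conjE)
  have FD4: "fst d \<in> forms {} (Suc (length el) + length (snd d))"
    and FD5: "divides R A (Suc (length el)) (fst d) (snd d)" if "d \<in> D" for d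
    using D that by (auto simp: case_prod_beta)
  have def_fibre: "definable R C 1 (\<lambda>a. holds R (a @ el) \<psi>)" if "\<psi> \<in> F" for \<psi>
  proof (rule definable_subst)
    show "definable R C (1 + length el) (\<lambda>a. holds R a \<psi>)"
      using FD(2) that by (intro definable_holds) (auto simp: tp_def)
    show "term_map R C 1 (1 + length el) (\<lambda>a. a @ el)"
      using assms by (intro term_map_append term_map_id term_map_const) auto
  qed
  have "generic_set {x. holds R ([x] @ el) \<psi>}" if "\<psi> \<in> F" for \<psi>
    using generic_eltD[OF assms(1) def_fibre[OF that]] FD(2) that by (auto simp: tp_def)
  moreover have "dset R {x. holds R ([x] @ el) \<psi>}" if "\<psi> \<in> F" for \<psi>
    using dset_definable[OF def_fibre[OF that]] .
  ultimately have "generic_set (\<Inter>\<psi>\<in>F. {x. holds R ([x] @ el) \<psi>})"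
    using FD(1) by (intro generic_INT)
  moreover have "(\<Inter>\<psi>\<in>F. {x. holds R ([x] @ el) \<psi>}) \<subseteq>
      (\<Union>d\<in>D. {x. holds R (x # el @ snd d) (fst d)})"
  proof
    fix x assume "x \<in> (\<Inter>\<psi>\<in>F. {x. holds R ([x] @ el) \<psi>})"
    then have "\<exists>(\<phi>, b)\<in>D. holds R ((x # el) @ b) \<phi>"
      by (intro cover[rule_format]) simp
    then show "x \<in> (\<Union>d\<in>D. {x. holds R (x # el @ snd d) (fst d)})"
      by (simp add: case_prod_beta)
  qed
  ultimately have "generic_set (\<Union>d\<in>D. {x. holds R (x # el @ snd d) (fst d)})"
    by (rule generic_set_mono)
  moreover have "dset R {x. holds R (x # el @ snd d) (fst d)}" if "d \<in> D" for d
  proof -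
    have "definable R {} (Suc (length (el @ snd d))) (\<lambda>a. holds R a (fst d))"
      using FD4[OF that] by (intro definable_holds) simp
    from dset_fibre[OF this] show ?thesis .
  qed
  ultimately obtain d where "d \<in> D" "generic_set {x. holds R (x # el @ snd d) (fst d)}"
    using generic_UN[OF FD(3), of "\<lambda>d. {x. holds R (x # el @ snd d) (fst d)}"] by auto
  then show False using generic_not_divides[OF assms(2) FD4] FD5 by simp
qed

end

locale stable_monster = stable_field R for R :: "'r \<Rightarrow> 'k::field list \<Rightarrow> bool" +
  fixes \<kappa> :: "'c rel"
  assumes monster: "monster R \<kappa>"
begin

lemma finite_small: "finite A \<Longrightarrow> |A| <o \<kappa>"
  using monster unfolding monster_def by (meson finite_iff_ordLess_natLeq ordLess_transitive)

lemma ex_generic_elt: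
  assumes "finite A"
  shows "\<exists>x. generic_elt R A x"
proof -
  from monster finite_small[OF assms] complete_gentype[of A]
  obtain a where a: "length a = 1" "tp R A a = gentype R A"
    unfolding monster_def by blast
  then obtain x where "a = [x]" by (auto simp: length_Suc_conv)
  with a show ?thesis unfolding generic_elt_iff_tp by auto
qed

text \<open>An element generic over \<open>A\<close> and all the elements generic over
  \<open>A\<close> is one of the latter, so finitely many would make a singleton generic. The
  infinitely many generics later serve as the conjugates that witness dividing.\<close>

lemma infinite_generic_elts:
  assumes "finite A"
  shows "infinite {x. generic_elt R A x}"
proof
  let ?C = "{x. generic_elt R A x}"
  assume "finite ?C"
  with assms obtain x where x: "generic_elt R (A \<union> ?C) x"
    using ex_generic_elt[of "A \<union> ?C"] by auto
  then have "x \<in> ?C" using generic_elt_mono by blast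
  then have "definable R (A \<union> ?C) 1 (\<lambda>a. a ! 0 = x)"
    by (intro definable_eq term_fun_intros) auto
  from generic_eltD[OF x this] have "generic_set {x}" by simp
  then show False using infinite_if_generic[OF inf] by blast
qed

end

section \<open>Coordinates of a generic element\<close>

text \<open>What the model-theoretic argument uses of the basis: \<open>P\<close> will be
  \<open>CHAR('k) ^ m\<close>, \<open>el\<close> a basis over the \<open>P\<close>-th powers, and
  \<open>rl x\<close> the \<open>P\<close>-th roots of the coordinates of \<open>x\<close>.
  Additivity \<open>rl_diff\<close> lets translates of the field act on the coordinates.\<close>

locale coordinates = stable_monster R \<kappa>
  for R :: "'r \<Rightarrow> 'k::field list \<Rightarrow> bool" and \<kappa> :: "'c rel" +
  fixes P :: nat and el :: "'k list" and rl :: "'k \<Rightarrow> 'k list"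
  assumes length_rl: "length (rl x) = length el"
    and sum_rl: "(\<Sum>i<length el. rl x ! i ^ P * el ! i) = x"
    and rl_sum: "length zs = length el \<Longrightarrow> rl (\<Sum>i<length el. zs ! i ^ P * el ! i) = zs"
    and rl_diff: "i < length el \<Longrightarrow> rl (x - y) ! i = rl x ! i - rl y ! i"
    and distinct_el: "distinct el"
begin

lemma sum_eq_iff_rl:
  "length zs = length el \<Longrightarrow> x = (\<Sum>i<length el. zs ! i ^ P * el ! i) \<longleftrightarrow> zs = rl x"
  using sum_rl[of x] rl_sum[of zs] by auto

lemma definable_rl:
  assumes "definable R A (length el) Q" "set el \<subseteq> A"
  shows "definable R A 1 (\<lambda>a. Q (rl (a ! 0)))"
proof -
  let ?q = "length el"
  \<comment> \<open>The coordinates are not terms in \<open>a\<close>, but the unique solution of an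
    equation, hence the quantifier. The tuple has the \<open>?q\<close> coordinates first and
    \<open>a\<close> at position \<open>?q\<close>.\<close>
  have "definable R A (?q + 1)
    (\<lambda>a. a ! ?q = (\<Sum>i<?q. a ! i ^ P * el ! i) \<and> Q (take ?q a))"
  proof (intro definable_conj definable_eq definable_subst[OF assms(1)] term_map_take)
    show "term_fun R A (?q + 1) (\<lambda>a. \<Sum>i<?q. a ! i ^ P * el ! i)"
      using assms(2) nth_mem[of _ el] by (intro term_fun_intros) auto
  qed (auto intro: term_fun_nth)
  from definable_ex_list[OF this] show ?thesis
  proof (rule definable_cong)
    fix a :: "'k list" assume "length a = 1"
    then have *: "((zs @ a) ! ?q = (\<Sum>i<?q. (zs @ a) ! i ^ P * el ! i) \<and> Q (take ?q (zs @ a))) \<longleftrightarrow>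
        zs = rl (a ! 0) \<and> Q zs" if "length zs = ?q" for zs
      using that sum_eq_iff_rl[of zs "a ! 0"] by (auto simp: nth_append)
    show "(\<exists>zs. length zs = ?q \<and> (zs @ a) ! ?q = (\<Sum>i<?q. (zs @ a) ! i ^ P * el ! i) \<and>
        Q (take ?q (zs @ a))) \<longleftrightarrow> Q (rl (a ! 0))"
      using * length_rl by metis
  qed
qed

text \<open>
  If not, there is a generic set of elements which has all its fibres in the direction of the \<open>i\<close>-th coordinate
  not generic, uniformly so. Finitely many translates of it cover the field, hence finitely many
  translates of such fibres cover the \<open>i\<close>-th axis.
\<close>

lemma generic_coordinate:
  assumes a: "generic_elt R (set el) a" and i: "i < length el"
  shows "generic_elt R (set el \<union> {rl a ! j |j. j < length el \<and> j \<noteq> i}) (rl a ! i)"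
  unfolding generic_elt_def
proof (intro ballI impI)
  let ?q = "length el" and ?E = "set el"
  let ?C = "?E \<union> {rl a ! j |j. j < ?q \<and> j \<noteq> i}"
  fix \<phi> :: "('r, 'k) fm"
  assume "\<phi> \<in> forms ?C 1" and holds: "holds R [rl a ! i] \<phi>"
  from definable_unpar[OF definable_holds[OF this(1), of R]] obtain c Q where
    c: "set c \<subseteq> ?C" and Q: "definable R {} (1 + length c) Q"
    and cQ: "\<forall>a. length a = 1 \<longrightarrow> (holds R a \<phi> \<longleftrightarrow> Q (a @ c))" by (elim exE conjE)
  have Q1: "definable R {} (Suc (length c)) Q" using Q by simp
  \<comment> \<open>A single \<open>N\<close> for all parameters lets \<open>B\<close> below express
    by one formula that the fibre is not generic.\<close>
  obtain N where N: "\<forall>b. length b = length c \<longrightarrow>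
      (generic_set {x. Q (x # b)} \<longleftrightarrow> ngen N {x. Q (x # b)})"
    using generic_uniform[OF Q1] .
  have "\<exists>j. d \<notin> ?E \<longrightarrow> j < ?q \<and> j \<noteq> i \<and> rl a ! j = d" if "d \<in> set c" for d
    using c that by auto
  then obtain ix where ix: "\<And>d. d \<in> set c \<Longrightarrow> d \<notin> ?E \<Longrightarrow> ix d < ?q \<and> ix d \<noteq> i \<and> rl a ! ix d = d"
    by metis
  \<comment> \<open>Rewrites the parameters of the formula as functions of the coordinates, with the
    basis elements as constants. The \<open>i\<close>-th coordinate does not enter, so
    \<open>G\<close> is constant along the \<open>i\<close>-th axis.\<close>
  define G where "G = (\<lambda>zs. map (\<lambda>d. if d \<in> ?E then d else zs ! ix d) c)"
  have G_a: "G (rl a) = c" unfolding G_def using ix by (auto intro: map_idI)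
  have G_length: "length (G zs) = length c" for zs unfolding G_def by simp
  have G_cong: "G zs = G ws" if "\<And>j. j < ?q \<Longrightarrow> j \<noteq> i \<Longrightarrow> zs ! j = ws ! j" for zs ws
    unfolding G_def using ix that by auto
  show "generic_set {y. holds R [y] \<phi>}"
  proof (rule ccontr)
    assume not_generic: "\<not> generic_set {y. holds R [y] \<phi>}"
    define B where "B = (\<lambda>zs. Q (zs ! i # G zs) \<and> \<not> ngen N {y. Q (y # G zs)})"
    have G_map: "term_map R ?E ?q (length c) G"
      unfolding G_def
    proof (rule term_map_map)
      fix d assume "d \<in> set c"
      then show "term_fun R ?E ?q (\<lambda>zs. if d \<in> ?E then d else zs ! ix d)"
        using ix[of d] by (cases "d \<in> ?E") (auto intro: term_fun_intros)
    qed
    have "definable R ?E ?q (\<lambda>zs. Q (zs ! i # G zs))"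
      by (rule definable_subst[OF definable_mono[OF Q1 empty_subsetI]])
        (rule term_map_Cons[OF term_fun_nth[OF i] G_map])
    moreover have "definable R ?E ?q (\<lambda>zs. ngen N {y. Q (y # G zs)})"
      by (rule definable_subst[OF definable_mono[OF definable_ngen[OF Q1] empty_subsetI] G_map])
    ultimately have "definable R ?E ?q B"
      unfolding B_def by (intro definable_conj definable_Not)
    from definable_rl[OF this] have defB: "definable R ?E 1 (\<lambda>a. B (rl (a ! 0)))" by simp
    have Q_eq: "holds R [y] \<phi> \<longleftrightarrow> Q (y # c)" for y using cQ[rule_format, of "[y]"] by simp
    have "B (rl a)"
      using holds not_generic N[rule_format, of c] unfolding B_def G_a Q_eq by simp
    with generic_eltD[OF a defB] have "generic_set {x. B (rl x)}" by simp
    from generic_setE[OF this] obtain T where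
      T: "finite T" "\<forall>x. \<exists>t\<in>T. x - t \<in> {x. B (rl x)}" .
    \<comment> \<open>The fibre in the direction of the \<open>i\<close>-th axis through
      \<open>- t\<close>. Translates by those \<open>t\<close> whose fibre is
      \<open>N\<close>-generic cover nothing on the axis, since \<open>B\<close> excludes such
      fibres.\<close>
    define X where "X = (\<lambda>t. {y. Q (y # G (rl (- t)))})"
    define T' where "T' = {t \<in> T. \<not> ngen N (X t)}"
    have "\<exists>t\<in>T'. y - rl t ! i \<in> X t" for y
    proof -
      \<comment> \<open>The point of the \<open>i\<close>-th axis at \<open>y\<close>: apart from
        the \<open>i\<close>-th, the coordinates of \<open>x - t\<close> are those of
        \<open>- t\<close>.\<close>
      define x where "x = (\<Sum>j<?q. (replicate ?q 0)[i := y] ! j ^ P * el ! j)"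
      have rl_x: "rl x = (replicate ?q 0)[i := y]" unfolding x_def by (rule rl_sum) simp
      from T(2) obtain t where t: "t \<in> T" "B (rl (x - t))" by auto
      have "rl 0 ! j = 0" if "j < ?q" for j using rl_diff[OF that, of 0 0] by simp
      then have "G (rl (x - t)) = G (rl (- t))"
        using rl_diff[of _ x t] rl_diff[of _ 0 t] rl_x by (intro G_cong) simp
      moreover have "rl (x - t) ! i = y - rl t ! i" using rl_diff[OF i, of x t] rl_x i by simp
      ultimately have "y - rl t ! i \<in> X t" "\<not> ngen N (X t)"
        using t(2) unfolding B_def X_def by simp_all
      with t(1) show ?thesis unfolding T'_def by blast
    qed
    then have "(\<Union>t\<in>T'. {y. y - rl t ! i \<in> X t}) = UNIV" by blast
    then have "generic_set (\<Union>t\<in>T'. {y. y - rl t ! i \<in> X t})" using generic_set_UNIV by simp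
    moreover have dX: "dset R (X t)" for t
      unfolding X_def using Q1 by (intro dset_fibre) (simp add: G_length)
    moreover have "finite T'" unfolding T'_def using T(1) by simp
    ultimately obtain t where t: "t \<in> T'" "generic_set {y. y - rl t ! i \<in> X t}"
      using generic_UN[of T' "\<lambda>t. {y. y - rl t ! i \<in> X t}"] dset_translate by blast
    then have "generic_set (X t)" using generic_set_translates[of "{rl t ! i}" "X t"] by simp
    then have "ngen N (X t)" using N G_length unfolding X_def by simp
    with t(1) show False unfolding T'_def by simp
  qed
qed

text \<open>
  The set of elements whose \<open>i\<close>-th coordinate is \<open>y\<close> divides over the empty set when \<open>y\<close> is
  generic over the basis, since distinct values of \<open>y\<close> give disjoint sets.
\<close>

lemma generic_depends_on_coordinate:
  assumes a: "generic_elt R (set el) a" and i: "i < length el"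
  shows "\<not> indep R [a] {} (set (rl a ! i # el))"
proof -
  let ?q = "length el" and ?E = "set el"
  let ?b = "rl a ! i # el"
  \<comment> \<open>Layout of \<open>v\<close>: the \<open>?q\<close> coordinates, then the element,
    the prescribed value of its \<open>i\<close>-th coordinate, and the basis from
    \<open>?q + 2\<close> on. As the basis is part of the tuple, the formula has no
    parameters.\<close>
  let ?Z = "\<lambda>v. v ! (?q + 1) = v ! i \<and>
    v ! ?q = (\<Sum>j<?q. v ! j ^ P * v ! (?q + 2 + j))"
  have "definable R {} (?q + (1 + length ?b)) ?Z"
    using i by (intro definable_conj definable_eq term_fun_intros) auto
  from definable_ex_list[OF this] obtain \<phi> where \<phi>: "\<phi> \<in> forms {} (1 + length ?b)"
    "\<And>v. length v = 1 + length ?b \<Longrightarrow> (\<exists>zs. length zs = ?q \<and> ?Z (zs @ v)) \<longleftrightarrow> holds R v \<phi>"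
    unfolding definable_def by auto
  have \<phi>_iff: "holds R (x # y # el) \<phi> \<longleftrightarrow> rl x ! i = y" for x y
  proof -
    have "?Z (zs @ x # y # el) \<longleftrightarrow> zs = rl x \<and> zs ! i = y" if "length zs = ?q" for zs
      using that i sum_eq_iff_rl[OF that, of x] by (auto simp: nth_append)
    then show ?thesis using \<phi>(2)[of "x # y # el"] length_rl[of x] by auto
  qed
  obtain f :: "nat \<Rightarrow> 'k" where f: "inj f" "range f \<subseteq> {x. generic_elt R ?E x}"
    using infinite_countable_subset[OF infinite_generic_elts[of ?E]] by auto
  \<comment> \<open>Equal types over the basis give equal types over the empty set for the tuples
    with the basis appended; hence the \<open>f n\<close> are taken generic over
    \<open>?E\<close>.\<close>
  have tp_f: "tp R {} (f n # el) = tp R {} ?b" for n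
  proof -
    have "generic_elt R ?E (f n)" using f(2) by auto
    moreover have "generic_elt R ?E (rl a ! i)"
      by (rule generic_elt_mono[OF generic_coordinate[OF a i]]) auto
    ultimately have eq: "tp R ?E [f n] = tp R ?E [rl a ! i]"
      unfolding generic_elt_iff_tp by simp
    have "holds R (f n # el) \<psi> \<longleftrightarrow> holds R ?b \<psi>" if "\<psi> \<in> forms {} (Suc ?q)" for \<psi>
    proof -
      have "definable R ?E (length [rl a ! i]) (\<lambda>v. holds R (v @ el) \<psi>)"
      proof (rule definable_subst)
        show "definable R ?E (1 + ?q) (\<lambda>v. holds R v \<psi>)"
          using definable_mono[OF definable_holds[OF that]] by simp
        show "term_map R ?E (length [rl a ! i]) (1 + ?q) (\<lambda>v. v @ el)"
          using term_map_append[OF term_map_id term_map_const, of el ?E R 1] by simp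
      qed
      from tp_eq_definable[OF eq _ this] show ?thesis by simp
    qed
    then show ?thesis unfolding tp_def by auto
  qed
  have div: "divides R {} 1 \<phi> ?b"
    unfolding divides_def
  proof (rule exI[of _ 2], rule exI[of _ "\<lambda>n. f n # el"], intro conjI allI impI)
    fix I :: "nat set" assume "finite I \<and> card I = 2"
    then obtain m n where mn: "m \<noteq> n" "m \<in> I" "n \<in> I" by (auto simp: card_2_iff)
    show "\<not> (\<exists>a. length a = 1 \<and> (\<forall>i\<in>I. holds R (a @ f i # el) \<phi>))"
    proof
      assume "\<exists>a. length a = 1 \<and> (\<forall>i\<in>I. holds R (a @ f i # el) \<phi>)"
      then obtain v where v: "length v = 1" "\<forall>i\<in>I. holds R (v @ f i # el) \<phi>" by blast
      from v(1) obtain x where "v = [x]" by (auto simp: length_Suc_conv)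
      with v(2) have "\<forall>j\<in>I. rl x ! i = f j" using \<phi>_iff by simp
      with mn have "f m = f n" by metis
      with f(1) mn(1) show False by (simp add: inj_eq)
    qed
  qed (use tp_f in auto)
  have "definable R (set ?b) 1 (\<lambda>v. holds R (v @ ?b) \<phi>)"
  proof (rule definable_subst)
    show "definable R (set ?b) (1 + length ?b) (\<lambda>v. holds R v \<phi>)"
      using definable_mono[OF definable_holds[OF \<phi>(1)]] by simp
    show "term_map R (set ?b) 1 (1 + length ?b) (\<lambda>v. v @ ?b)"
      by (intro term_map_append term_map_id term_map_const) simp
  qed
  then obtain \<psi> where \<psi>: "\<psi> \<in> forms (set ?b) 1"
    "\<And>v. length v = 1 \<Longrightarrow> holds R (v @ ?b) \<phi> \<longleftrightarrow> holds R v \<psi>"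
    unfolding definable_def by auto
  have "forks R {} (length [a]) (tp R ({} \<union> set ?b) [a])"
    unfolding forks_def
  proof (intro exI[of _ "{\<psi>}"] exI[of _ "{(\<phi>, ?b)}"] conjI)
    have "holds R [a] \<psi>" using \<psi>(2)[of "[a]"] \<phi>_iff by simp
    then show "{\<psi>} \<subseteq> tp R ({} \<union> set ?b) [a]" using \<psi>(1) unfolding tp_def by simp
    show "\<forall>(\<phi>, b)\<in>{(\<phi>, ?b)}. \<phi> \<in> forms {} (length [a] + length b) \<and> divides R {} (length [a]) \<phi> b"
      using \<phi>(1) div by simp
    show "\<forall>v. length v = length [a] \<and> (\<forall>\<psi>\<in>{\<psi>}. holds R v \<psi>) \<longrightarrow>
        (\<exists>(\<phi>, b)\<in>{(\<phi>, ?b)}. holds R (v @ b) \<phi>)"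
      using \<psi>(2) by simp
  qed simp_all
  then show ?thesis unfolding indep_def by simp
qed

lemma length_el_le_weight: "enat (length el) \<le> field_weight R \<kappa>"
proof -
  let ?E = "set el"
  obtain a where a: "generic_elt R ?E a" using ex_generic_elt[of ?E] by auto
  \<comment> \<open>The index sets in \<open>weight\<close> are sets of field elements, so the
    family is indexed by the basis itself, and \<open>ix\<close> recovers positions.\<close>
  define ix where "ix = (\<lambda>e. SOME i. i < length el \<and> el ! i = e)"
  have ix: "ix e < length el \<and> el ! ix e = e" if "e \<in> ?E" for e
    unfolding ix_def by (rule someI_ex) (use that in \<open>auto simp: in_set_conv_nth\<close>)
  define b where "b = (\<lambda>e. rl a ! ix e # el)"
  have "weight_witness R \<kappa> {} (gentype R {}) ?E [a] ?E b"
    unfolding weight_witness_def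
  proof (intro conjI ballI)
    show "tp R {} [a] = gentype R {}"
      using generic_elt_mono[OF a, of "{}"] unfolding generic_elt_iff_tp by simp
    show "indep R [a] {} ?E"
      using generic_not_forks[OF a, of "[]" "{}"] unfolding indep_def by simp
    show "indep_family R ?E ?E b"
      unfolding indep_family_def
    proof
      fix e assume e: "e \<in> ?E"
      let ?C = "?E \<union> {rl a ! j |j. j < length el \<and> j \<noteq> ix e}"
      have "rl a ! ix e' \<in> ?C" if "e' \<in> ?E - {e}" for e'
        using ix[of e'] ix[OF e] that by fastforce
      then have "?E \<union> (\<Union>j\<in>?E - {e}. set (b j)) \<subseteq> ?C" unfolding b_def by auto
      from generic_elt_mono[OF generic_coordinate[OF a] this] ix[OF e]
      have "generic_elt R (?E \<union> (\<Union>j\<in>?E - {e}. set (b j))) (rl a ! ix e)" by simp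
      from generic_not_forks[OF this, of el ?E]
      show "indep R (b e) ?E (\<Union>j\<in>?E - {e}. set (b j))"
        unfolding indep_def b_def by simp
    qed
    show "\<not> indep R [a] {} (set (b e))" if "e \<in> ?E" for e
      using generic_depends_on_coordinate[OF a] ix[OF that] unfolding b_def by simp
  qed (simp_all add: finite_small)
  then have "enat (card ?E) \<in> {(if finite I then enat (card I) else \<infinity>) | I :: 'k set.
      \<exists>B a b. weight_witness R \<kappa> {} (gentype R {}) B a I b}"
    by (intro CollectI exI[of _ ?E]) auto
  then have "enat (card ?E) \<le> weight R \<kappa> {} (gentype R {})"
    unfolding weight_def by (rule Sup_upper)
  then show ?thesis
    unfolding field_weight_def the_generic_type using distinct_card[OF distinct_el] by simp
qed

end

section \<open>The field as a vector space over its Frobenius powers\<close>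

text \<open>
  Letting \<open>c\<close> act as multiplication by \<open>c ^ (p ^ m)\<close> makes the field a vector space over itself,
  which stands for the field as a vector space over its subfield of \<open>p ^ m\<close>-th powers.
\<close>

definition frob_scale :: "nat \<Rightarrow> 'k::field \<Rightarrow> 'k \<Rightarrow> 'k" where
  "frob_scale m c x = c ^ (CHAR('k) ^ m) * x"

lemma frob_diff:
  assumes "CHAR('k::field) > 0"
  shows "(x - y :: 'k) ^ (CHAR('k) ^ m) = x ^ (CHAR('k) ^ m) - y ^ (CHAR('k) ^ m)"
  using freshmans_dream'[OF prime_CHAR_semidom[OF assms] refl, of "x - y" y m]
  by (simp add: eq_diff_eq)

lemma frob_inj:
  assumes "CHAR('k::field) > 0" "(x :: 'k) ^ (CHAR('k) ^ m) = y ^ (CHAR('k) ^ m)"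
  shows "x = y"
  using frob_diff[OF assms(1), of x y m] assms by simp

lemma vector_space_frob_scale:
  assumes "CHAR('k::field) > 0"
  shows "vector_space (frob_scale m :: 'k \<Rightarrow> 'k \<Rightarrow> 'k)"
  by unfold_locales
    (simp_all add: frob_scale_def algebra_simps power_mult_distrib
      freshmans_dream'[OF prime_CHAR_semidom[OF assms] refl])

text \<open>Tower argument: expand a scalar \<open>c\<close> as a combination of \<open>E\<close>
  over the \<open>p\<close>-th powers and apply the \<open>p ^ m\<close>-th power map. So the
  \<open>e ^ (p ^ m) * b\<close> span over the \<open>p ^ (m + 1)\<close>-th powers when the
  \<open>b\<close> span over the \<open>p ^ m\<close>-th powers.\<close>

lemma finite_frob_span:
  assumes "CHAR('k::field) > 0" "finite_degree_of_imperfection TYPE('k)"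
  shows "\<exists>B :: 'k set. finite B \<and> module.span (frob_scale m) B = UNIV"
proof (induction m)
  case 0
  interpret V: vector_space "frob_scale 0 :: 'k \<Rightarrow> 'k \<Rightarrow> 'k"
    by (rule vector_space_frob_scale[OF assms(1)])
  have "x \<in> V.span {1}" for x :: 'k
    using V.span_scale[OF V.span_base[of 1 "{1}"], of x] by (simp add: frob_scale_def)
  then show ?case by blast
next
  case (Suc m)
  interpret V: vector_space "frob_scale m :: 'k \<Rightarrow> 'k \<Rightarrow> 'k"
    by (rule vector_space_frob_scale[OF assms(1)])
  interpret W: vector_space "frob_scale (Suc m) :: 'k \<Rightarrow> 'k \<Rightarrow> 'k"
    by (rule vector_space_frob_scale[OF assms(1)])
  from Suc obtain B :: "'k set" where B: "finite B" "V.span B = UNIV" by blast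
  from assms obtain E :: "'k set" where E: "finite E"
    "\<forall>x. \<exists>c. (\<forall>e\<in>E. c e \<in> pth_powers) \<and> x = (\<Sum>e\<in>E. c e * e)"
    unfolding finite_degree_of_imperfection_def by auto
  let ?P = "CHAR('k) ^ m"
  let ?B = "(\<lambda>(b, e). e ^ ?P * b) ` (B \<times> E)"
  have scale: "c ^ ?P * b \<in> W.span ?B" if "b \<in> B" for c b
  proof -
    from E(2) obtain d where d: "\<forall>e\<in>E. d e \<in> pth_powers" "c = (\<Sum>e\<in>E. d e * e)" by blast
    have "c ^ ?P * b = (\<Sum>e\<in>E. d e ^ ?P * (e ^ ?P * b))"
      unfolding d(2) freshmans_dream_sum'[OF prime_CHAR_semidom[OF assms(1)] refl]
      by (simp add: sum_distrib_right power_mult_distrib mult.assoc)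
    also have "\<dots> \<in> W.span ?B"
    proof (rule W.span_sum)
      fix e assume e: "e \<in> E"
      with d(1) obtain f where "d e = f ^ CHAR('k)" unfolding pth_powers_def by auto
      then have "d e ^ ?P * (e ^ ?P * b) = frob_scale (Suc m) f (e ^ ?P * b)"
        unfolding frob_scale_def by (simp add: power_mult)
      moreover have "e ^ ?P * b \<in> W.span ?B" using that e by (intro W.span_base) auto
      ultimately show "d e ^ ?P * (e ^ ?P * b) \<in> W.span ?B" using W.span_scale by simp
    qed
    finally show ?thesis .
  qed
  have "x \<in> W.span ?B" for x
  proof -
    have "x \<in> V.span B" using B(2) by simp
    then show ?thesis
    proof (induction rule: V.span_induct_alt)
      case base
      show ?case by (rule W.span_zero)
    next
      case (step c b y)
      have "frob_scale m c b = c ^ ?P * b" by (simp add: frob_scale_def)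
      with W.span_add[OF scale[OF step(1)] step(2)] show ?case by simp
    qed
  qed
  moreover have "finite ?B" using B(1) E(1) by simp
  ultimately show ?case by blast
qed

lemma power_power_split:
  fixes c :: "'a::monoid_mult"
  shows "j \<le> n \<Longrightarrow> c ^ (p ^ n) = (c ^ (p ^ (n - j))) ^ (p ^ j)"
  by (simp only: power_mult[symmetric] power_add[symmetric] le_add_diff_inverse2)

text \<open>
  If \<open>x\<close> is not a \<open>p\<close>-th power, then \<open>x ^ (p ^ i)\<close> lies outside the subspace of
  \<open>p ^ (i + 1)\<close>-th powers, which contains \<open>x ^ (p ^ j)\<close> for \<open>j > i\<close>.
\<close>

lemma frob_independent:
  assumes "CHAR('k::field) > 0" "(x :: 'k) \<notin> pth_powers" "i \<le> m"
  shows "\<not> module.dependent (frob_scale m) ((\<lambda>j. x ^ (CHAR('k) ^ j)) ` {i..<m}) \<and>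
    card ((\<lambda>j. x ^ (CHAR('k) ^ j)) ` {i..<m}) = m - i"
  using assms(3)
proof (induction rule: inc_induct)
  case base
  interpret V: vector_space "frob_scale m :: 'k \<Rightarrow> 'k \<Rightarrow> 'k"
    by (rule vector_space_frob_scale[OF assms(1)])
  show ?case using V.independent_empty by simp
next
  case (step i)
  interpret V: vector_space "frob_scale m :: 'k \<Rightarrow> 'k \<Rightarrow> 'k"
    by (rule vector_space_frob_scale[OF assms(1)])
  let ?p = "CHAR('k)"
  \<comment> \<open>Closed under scaling because \<open>Suc i \<le> m\<close>: the scalars
    \<open>c ^ (p ^ m)\<close> are themselves \<open>p ^ Suc i\<close>-th powers.\<close>
  let ?U = "range (\<lambda>y :: 'k. y ^ (?p ^ Suc i))"
  let ?S = "\<lambda>i. (\<lambda>j. x ^ (?p ^ j)) ` {i..<m}"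
  have "V.subspace ?U"
  proof (rule V.subspaceI)
    show "0 \<in> ?U" using assms(1) by (intro image_eqI[of _ _ 0]) (auto simp: power_0_left)
    show "a + b \<in> ?U" if "a \<in> ?U" "b \<in> ?U" for a b
    proof -
      from that obtain y z where "a = y ^ (?p ^ Suc i)" "b = z ^ (?p ^ Suc i)" by auto
      then have "a + b = (y + z) ^ (?p ^ Suc i)"
        by (simp only: freshmans_dream'[OF prime_CHAR_semidom[OF assms(1)] refl])
      then show ?thesis by (rule range_eqI)
    qed
    show "frob_scale m c a \<in> ?U" if "a \<in> ?U" for c a
    proof -
      from that obtain y where "a = y ^ (?p ^ Suc i)" by auto
      moreover have "c ^ (?p ^ m) = (c ^ (?p ^ (m - Suc i))) ^ (?p ^ Suc i)"
        using step.hyps by (intro power_power_split) simp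
      ultimately show ?thesis
        unfolding frob_scale_def
        by (intro image_eqI[of _ _ "c ^ (?p ^ (m - Suc i)) * y"]) (simp_all add: power_mult_distrib)
    qed
  qed
  moreover have "?S (Suc i) \<subseteq> ?U"
  proof clarify
    fix j assume "j \<in> {Suc i..<m}"
    then have "x ^ (?p ^ j) = (x ^ (?p ^ (j - Suc i))) ^ (?p ^ Suc i)"
      by (intro power_power_split) simp
    then show "x ^ (?p ^ j) \<in> ?U" by (rule range_eqI)
  qed
  ultimately have "V.span (?S (Suc i)) \<subseteq> ?U" by (rule V.span_minimal[rotated])
  moreover have "x ^ (?p ^ i) \<notin> ?U"
  proof
    assume "x ^ (?p ^ i) \<in> ?U"
    then obtain y where "x ^ (?p ^ i) = (y ^ ?p) ^ (?p ^ i)" by (auto simp flip: power_mult)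
    then have "x = y ^ ?p" by (rule frob_inj[OF assms(1)])
    with assms(2) show False unfolding pth_powers_def by auto
  qed
  ultimately have new: "x ^ (?p ^ i) \<notin> V.span (?S (Suc i))" by blast
  have "{i..<m} = insert i {Suc i..<m}" using step.hyps by auto
  then have S: "?S i = insert (x ^ (?p ^ i)) (?S (Suc i))" by simp
  have "x ^ (?p ^ i) \<notin> ?S (Suc i)" using new by (rule contrapos_nn) (rule V.span_base)
  then have "card (?S i) = Suc (card (?S (Suc i)))" unfolding S by (subst card_insert_disjoint) auto
  then show ?case
    using step V.independent_insertI[OF new] unfolding S by simp
qed

context stable_monster
begin

lemma le_field_weight:
  assumes "finite_degree_of_imperfection TYPE('k)" "\<not> perfect TYPE('k)"
  shows "enat m \<le> field_weight R \<kappa>"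
proof -
  interpret V: vector_space "frob_scale m :: 'k \<Rightarrow> 'k \<Rightarrow> 'k"
    by (rule vector_space_frob_scale[OF char_pos])
  let ?P = "CHAR('k) ^ m"
  obtain B :: "'k set" where B: "finite B" "V.span B = UNIV"
    using finite_frob_span[OF char_pos assms(1)] by blast
  obtain E where E: "E \<subseteq> B" "V.independent E" "B \<subseteq> V.span E"
    using V.maximal_independent_subset[of B] .
  then have span: "V.span E = UNIV" using B(2) V.span_minimal[OF E(3) V.subspace_span] by auto
  have "finite E" using E(1) B(1) finite_subset by blast
  then obtain el where el: "set el = E" "distinct el" using finite_distinct_list by blast
  \<comment> \<open>Since \<open>c\<close> acts as multiplication by \<open>c ^ ?P\<close>, the
    representation consists of the \<open>?P\<close>-th roots of the coordinates.\<close>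
  define rl where "rl = (\<lambda>x. map (V.representation E x) el)"
  interpret coordinates R \<kappa> ?P el rl
  proof
    show "length (rl x) = length el" for x unfolding rl_def by simp
    show "(\<Sum>i<length el. rl x ! i ^ ?P * el ! i) = x" for x
    proof -
      have "(\<Sum>i<length el. rl x ! i ^ ?P * el ! i) =
          (\<Sum>i<length el. frob_scale m (V.representation E x (el ! i)) (el ! i))"
        unfolding rl_def frob_scale_def by (intro sum.cong) auto
      also have "\<dots> = (\<Sum>e\<in>E. frob_scale m (V.representation E x e) e)"
        using sum.reindex_bij_betw[OF bij_betw_nth[OF el(2) refl el(1)[symmetric]],
            of "\<lambda>e. frob_scale m (V.representation E x e) e"] .
      also have "\<dots> = x"
        using span by (intro V.sum_representation_eq[OF E(2) _ \<open>finite E\<close>]) auto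
      finally show ?thesis .
    qed
    show "rl (\<Sum>i<length el. zs ! i ^ ?P * el ! i) = zs" if zs: "length zs = length el" for zs
    proof (rule nth_equalityI)
      fix k assume "k < length (rl (\<Sum>i<length el. zs ! i ^ ?P * el ! i))"
      then have k: "k < length el" unfolding rl_def by simp
      have "V.representation E (\<Sum>i<length el. frob_scale m (zs ! i) (el ! i)) (el ! k) =
          (\<Sum>i<length el. V.representation E (frob_scale m (zs ! i) (el ! i)) (el ! k))"
        using span by (subst V.representation_sum[OF E(2)]) auto
      also have "\<dots> = (\<Sum>i<length el. zs ! i * (if i = k then 1 else 0))"
      proof (rule sum.cong[OF refl])
        fix i assume "i \<in> {..<length el}"
        then have i: "i < length el" "el ! i \<in> E" using el(1) by auto
        have "V.representation E (frob_scale m (zs ! i) (el ! i)) (el ! k) =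
            zs ! i * V.representation E (el ! i) (el ! k)"
          using V.representation_scale[OF E(2) V.span_base[OF i(2)]] by simp
        also have "V.representation E (el ! i) (el ! k) = (if i = k then 1 else 0)"
          using V.representation_basis[OF E(2) i(2)] nth_eq_iff_index_eq[OF el(2) i(1) k] by auto
        finally show "V.representation E (frob_scale m (zs ! i) (el ! i)) (el ! k) =
            zs ! i * (if i = k then 1 else 0)" .
      qed
      also have "\<dots> = zs ! k" using k by (simp add: if_distrib cong: if_cong)
      finally show "rl (\<Sum>i<length el. zs ! i ^ ?P * el ! i) ! k = zs ! k"
        using k unfolding rl_def frob_scale_def by simp
    qed (simp add: zs rl_def)
    show "rl (x - y) ! i = rl x ! i - rl y ! i" if "i < length el" for i x y
      using that span unfolding rl_def by (simp add: V.representation_diff[OF E(2)])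
  qed (rule el(2))
  from assms(2) obtain x :: 'k where x: "x \<notin> pth_powers" unfolding perfect_def by auto
  let ?S = "(\<lambda>j. x ^ (CHAR('k) ^ j)) ` {0..<m}"
  have "m = card ?S" "V.independent ?S"
    using frob_independent[OF char_pos x, of 0 m] by auto
  moreover from this(2) have "card ?S \<le> card E"
    using V.independent_span_bound[OF \<open>finite E\<close>, of ?S] span by simp
  ultimately have "m \<le> length el" using el distinct_card by fastforce
  then have "enat m \<le> enat (length el)" by simp
  also have "\<dots> \<le> field_weight R \<kappa>" by (rule length_el_le_weight)
  finally show ?thesis .
qed

end

theorem proposition3p5:
  fixes R :: "'r \<Rightarrow> 'k::field list \<Rightarrow> bool"
    and \<kappa> :: "'c rel"
  assumes "infinite (UNIV :: 'k set)"
    and "monster R \<kappa>"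
    and "stable R"
    and "field_weight R \<kappa> < \<infinity>"
    and "finite_degree_of_imperfection TYPE('k)"
  shows "perfect TYPE('k)"
proof (rule ccontr)
  assume not_perfect: "\<not> perfect TYPE('k)"
  then have "CHAR('k) > 0" unfolding perfect_def by simp
  then interpret stable_monster R \<kappa>
    using assms(1-3) by unfold_locales
  have "enat m \<le> field_weight R \<kappa>" for m
    by (rule le_field_weight[OF assms(5) not_perfect])
  moreover obtain w where "field_weight R \<kappa> = enat w" using assms(4) by auto
  ultimately show False using Suc_n_not_le_n by (metis enat_ord_simps(1))
qed

end
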